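(* Let $\alpha,\beta\in(0,1)$ be fixed, $J=\{1,\dots,N\}$ with $N\ge2$, $0<p<2$, $R>0$, and let $a=(a_j)$ be a monotone non-decreasing sequence of positive numbers. Consider $Z_j=b_j\theta_j+\sigma\epsilon_j$, $j\in J$, with $b_j>0$, $\sigma>0$ and $(\epsilon_j)$ i.i.d. standard normal, and put $Y_j=b_j^{-1}Z_j=\theta_j+\sigma_j\epsilon_j$, $\sigma_j=\sigma b_j^{-1}$. Assume that the sequence $\bigl(a_j^{-p}b_j^{-(2-p)}\bigr)_j$ is monotone non-increasing. Let $$\mathcal{E}_{a,p}(R)=\Bigl\{\nu\in l_2(J):\ \sum_{j\in J}a_j^p|\nu_j|^p\le R^p\Bigr\},\qquad \rho_{a,p,R}^2=\sup_{D\in J}\Bigl(\rho_{\lceil\sqrt D\rceil,D}^2\wedge(\sqrt D)^{1-2/p}R^2a_D^{-2}\Bigr),$$ and let $\Phi_\alpha^\dagger$ and $D^\dagger$ be the test and the index defined in the context. Then $$\sup_{\theta\in\mathcal{E}_{a,p}(R),\ \|\theta\|_2^2\ge\lambda_\sigma\rho_{a,p,R}^2}\mathbb{P}_\theta(\Phi_\alpha^\dagger=0)\le\beta,$$ with - $\lambda_\sigma=C\log(N)$ for mildly ill-posed problems, i.e. $b_j^{-1}\sim j^t$ for some $t>0$; - $\lambda_\sigma=C\log(N)\,\bigl(\sqrt{D^\dagger}\bigr)^{1-p/2}$ for severely ill-posed problems, i.e. $b_j^{-1}\sim e^{\gamma j}$ for some $\gamma>0$; where $C$ denotes a positive constant independent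 of $\sigma$.
   Context: $\mathbb{P}_\theta$ is the distribution of $Y=(Y_j)_{j\in J}$; $\|\theta\|_2^2=\sum_j\theta_j^2$; $x\vee y=\max(x,y)$, $x\wedge y=\min(x,y)$; $\lceil x\rceil=m+1$ where $m$ is the greatest integer (strictly) smaller than $x$. For positive sequences, $u_j\sim w_j$ means $c_1w_j\le u_j\le c_2w_j$ for all $j$, for some positive constants $c_1,c_2$. A supremum of probabilities over an empty set is $0$. Tests are $\{0,1\}$-valued functions of $Y$, and the value $1$ means rejection of "$\theta=0$". For integers $1\le k\le n\le N$, with $\sigma_{(1)}\le\dots\le\sigma_{(n)}$ the values $\sigma_1,\dots,\sigma_n$ in non-decreasing order and $\Sigma_{l,k}^2=\sum_{j=l+1}^{l+k}\sigma_{(j)}^2$, $$\rho_{k,n}^2=\Bigl[\max_{0\le l\le n-k}\Sigma_{l,k}^2\,\ln\Bigl(1+\Bigl(\frac{n-l}{k^2}\vee\sqrt{\frac{n-l}{k^2}}\Bigr)\Bigr)\Bigr]\vee\Bigl(\sum_{j=n-k+1}^n\sigma_{(j)}^4\Bigr)^{1/2}.$$ $D^\dagger=\inf\{D\in J:\ R^2a_D^{-2}(\sqrt D)^{1-2/p}\le\rho_{\lceil\sqrt D\rceil,D}^2\}$, with $D^\dagger=N$ if this set is empty. For $u\in(0,1)$ and $j\in J$, $\Phi_{\{j\},u}=\mathbf{1}_{\{|Y_j|\ge q_{j,u}\}}$, where $q_{j,u}$ is the $1-u$ quantile of the absolute value of a Gaussian variable with mean $0$ and variance $\sigma_j^2$.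 For $D\in J$, $\Phi_{D,u}=\mathbf{1}_{\{\sum_{j=1}^DY_j^2>t_{D,1-u}(\sigma)\}}$, where $t_{D,1-u}(\sigma)$ is the $1-u$ quantile of $\sum_{j=1}^D\sigma_j^2\epsilon_j^2$. Set $$\Phi_{\mathrm{loc},\alpha/2}=\sup_{j\in\{D^\dagger+1,\dots,N\}}\Phi_{\{j\},\,3\alpha/(\pi^2(j-D^\dagger)^2)}$$ (equal to $0$ if $D^\dagger=N$), and $\Phi_\alpha^\dagger=\max(\Phi_{\mathrm{loc},\alpha/2},\Phi_{D^\dagger,\alpha/2})$. *)

theory Defs
  imports "HOL-Probability.Probability"
begin

section \<open>The model\<close>

text \<open>
  A sequence indexed by \<open>J = {1..N}\<close> is a function on \<^typ>\<open>nat\<close> of which only the values on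
  \<open>{1..N}\<close> are used.  The noise vector has the law \<open>std_noise N\<close> of \<open>N\<close> independent standard
  normal variables.
\<close>

definition std_noise :: "nat \<Rightarrow> (nat \<Rightarrow> real) measure" where
  "std_noise N = (\<Pi>\<^sub>M j\<in>{1..N}. std_normal_distribution)"

definition observe_Z :: "real \<Rightarrow> (nat \<Rightarrow> real) \<Rightarrow> (nat \<Rightarrow> real) \<Rightarrow> (nat \<Rightarrow> real) \<Rightarrow> nat \<Rightarrow> real" where
  "observe_Z \<sigma> b \<theta> \<epsilon> j = b j * \<theta> j + \<sigma> * \<epsilon> j"

definition observe_Y ::
  "nat \<Rightarrow> real \<Rightarrow> (nat \<Rightarrow> real) \<Rightarrow> (nat \<Rightarrow> real) \<Rightarrow> (nat \<Rightarrow> real) \<Rightarrow> nat \<Rightarrow> real" where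
  "observe_Y N \<sigma> b \<theta> \<epsilon> = (\<lambda>j\<in>{1..N}. inverse (b j) * observe_Z \<sigma> b \<theta> \<epsilon> j)"

text \<open>The distribution of \<open>Y\<close> under the parameter \<open>\<theta>\<close>:\<close>

definition law_Y ::
  "nat \<Rightarrow> real \<Rightarrow> (nat \<Rightarrow> real) \<Rightarrow> (nat \<Rightarrow> real) \<Rightarrow> (nat \<Rightarrow> real) measure" where
  "law_Y N \<sigma> b \<theta> = distr (std_noise N) (\<Pi>\<^sub>M j\<in>{1..N}. borel) (observe_Y N \<sigma> b \<theta>)"

definition noise_level :: "real \<Rightarrow> (nat \<Rightarrow> real) \<Rightarrow> nat \<Rightarrow> real" where
  "noise_level \<sigma> b j = \<sigma> * inverse (b j)"

definition comparable_on ::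
  "nat set \<Rightarrow> real \<Rightarrow> real \<Rightarrow> (nat \<Rightarrow> real) \<Rightarrow> (nat \<Rightarrow> real) \<Rightarrow> bool" where
  "comparable_on J c1 c2 u w \<longleftrightarrow> (\<forall>j\<in>J. c1 * w j \<le> u j \<and> u j \<le> c2 * w j)"

text \<open>Since \<open>{1..N}\<close> is finite, \<open>l\<^sub>2({1..N})\<close> is the space of all real vectors indexed by it.\<close>

definition ellipsoid :: "nat \<Rightarrow> (nat \<Rightarrow> real) \<Rightarrow> real \<Rightarrow> real \<Rightarrow> (nat \<Rightarrow> real) set" where
  "ellipsoid N a p R =
     {\<nu> \<in> {1..N} \<rightarrow>\<^sub>E UNIV. (\<Sum>j = 1..N. a j powr p * \<bar>\<nu> j\<bar> powr p) \<le> R powr p}"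


section \<open>Separation rates\<close>

text \<open>
  The \<open>j\<close>-th smallest of the values \<open>s 1, \<dots>, s n\<close>, counted with multiplicity, for \<open>1 \<le> j \<le> n\<close>.
\<close>

definition order_stat :: "(nat \<Rightarrow> real) \<Rightarrow> nat \<Rightarrow> nat \<Rightarrow> real" where
  "order_stat s n j = sort (map s [1..<Suc n]) ! (j - 1)"

definition Sigma_sq :: "(nat \<Rightarrow> real) \<Rightarrow> nat \<Rightarrow> nat \<Rightarrow> nat \<Rightarrow> real" where
  "Sigma_sq s n l k = (\<Sum>j = l + 1..l + k. (order_stat s n j)\<^sup>2)"

definition rho_sq :: "(nat \<Rightarrow> real) \<Rightarrow> nat \<Rightarrow> nat \<Rightarrow> real" where
  "rho_sq s k n =
     max (Max ((\<lambda>l. Sigma_sq s n l k *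
                 ln (1 + max (real (n - l) / (real k)\<^sup>2) (sqrt (real (n - l) / (real k)\<^sup>2))))
               ` {0..n - k}))
         (sqrt (\<Sum>j = n - k + 1..n. (order_stat s n j) ^ 4))"

text \<open>\<open>\<rho>\<^bsub>k,D\<^esub>\<^sup>2\<close> with \<open>k\<close> the (usual) ceiling of \<open>\<surd>D\<close>, and \<open>R\<^sup>2 a\<^sub>D\<^sup>-\<^sup>2 (\<surd>D)\<^sup>1\<^sup>-\<^sup>2\<^sup>/\<^sup>p\<close>:\<close>

definition rho_sqrt_sq :: "(nat \<Rightarrow> real) \<Rightarrow> nat \<Rightarrow> real" where
  "rho_sqrt_sq s D = rho_sq s (nat \<lceil>sqrt (real D)\<rceil>) D"

definition bias_sq :: "(nat \<Rightarrow> real) \<Rightarrow> real \<Rightarrow> real \<Rightarrow> nat \<Rightarrow> real" where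
  "bias_sq a p R D = R\<^sup>2 / (a D)\<^sup>2 * sqrt (real D) powr (1 - 2 / p)"

definition rate_sq :: "nat \<Rightarrow> (nat \<Rightarrow> real) \<Rightarrow> (nat \<Rightarrow> real) \<Rightarrow> real \<Rightarrow> real \<Rightarrow> real" where
  "rate_sq N s a p R = (\<Squnion>D\<in>{1..N}. min (rho_sqrt_sq s D) (bias_sq a p R D))"

definition D_dagger :: "nat \<Rightarrow> (nat \<Rightarrow> real) \<Rightarrow> (nat \<Rightarrow> real) \<Rightarrow> real \<Rightarrow> real \<Rightarrow> nat" where
  "D_dagger N s a p R =
     (let S = {D \<in> {1..N}. bias_sq a p R D \<le> rho_sqrt_sq s D}
      in if S = {} then N else Inf S)"


section \<open>The tests\<close>

definition quantile :: "real measure \<Rightarrow> real \<Rightarrow> real" where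
  "quantile M u = Inf {x. u \<le> cdf M x}"

text \<open>
  The standard deviation \<open>\<sigma>\<^sub>j > 0\<close>, not the variance, is the second argument of
  \<^const>\<open>normal_density\<close>.
\<close>

definition q_coord :: "(nat \<Rightarrow> real) \<Rightarrow> nat \<Rightarrow> real \<Rightarrow> real" where
  "q_coord s j u = quantile (distr (density lborel (normal_density 0 (s j))) borel abs) (1 - u)"

definition t_sum :: "(nat \<Rightarrow> real) \<Rightarrow> nat \<Rightarrow> real \<Rightarrow> real" where
  "t_sum s D v = quantile (distr (std_noise D) borel (\<lambda>\<epsilon>. \<Sum>j = 1..D. (s j)\<^sup>2 * (\<epsilon> j)\<^sup>2)) v"

definition test_coord :: "(nat \<Rightarrow> real) \<Rightarrow> nat \<Rightarrow> real \<Rightarrow> (nat \<Rightarrow> real) \<Rightarrow> nat" where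
  "test_coord s j u y = of_bool (\<bar>y j\<bar> \<ge> q_coord s j u)"

definition test_sum :: "(nat \<Rightarrow> real) \<Rightarrow> nat \<Rightarrow> real \<Rightarrow> (nat \<Rightarrow> real) \<Rightarrow> nat" where
  "test_sum s D u y = of_bool ((\<Sum>j = 1..D. (y j)\<^sup>2) > t_sum s D (1 - u))"

text \<open>
  \<open>test_loc N s D \<alpha>\<close> is \<open>\<Phi>\<^bsub>loc,\<alpha>/2\<^esub>\<close>: the levels \<open>3\<alpha>/(\<pi>\<^sup>2 i\<^sup>2)\<close> sum up to \<open>\<alpha>/2\<close>.
  The supremum is taken in \<^typ>\<open>nat\<close>, where that of the empty set is \<open>0\<close>.
\<close>

definition test_loc :: "nat \<Rightarrow> (nat \<Rightarrow> real) \<Rightarrow> nat \<Rightarrow> real \<Rightarrow> (nat \<Rightarrow> real) \<Rightarrow> nat" where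
  "test_loc N s D \<alpha> y =
     (\<Squnion>j\<in>{D + 1..N}. test_coord s j (3 * \<alpha> / (pi\<^sup>2 * (real (j - D))\<^sup>2)) y)"

definition test_dagger ::
  "nat \<Rightarrow> (nat \<Rightarrow> real) \<Rightarrow> (nat \<Rightarrow> real) \<Rightarrow> real \<Rightarrow> real \<Rightarrow> real \<Rightarrow> (nat \<Rightarrow> real) \<Rightarrow> nat" where
  "test_dagger N s a p R \<alpha> y =
     max (test_loc N s (D_dagger N s a p R) \<alpha> y) (test_sum s (D_dagger N s a p R) (\<alpha> / 2) y)"

text \<open>
  Suprema of probabilities are taken in \<^typ>\<open>ennreal\<close>, where the supremum over the empty set
  is \<open>0\<close>.
\<close>

definition sup_type_II_error ::
  "nat \<Rightarrow> real \<Rightarrow> (nat \<Rightarrow> real) \<Rightarrow> (nat \<Rightarrow> real) \<Rightarrow> real \<Rightarrow> real \<Rightarrow> real \<Rightarrow> real \<Rightarrow> ennreal" where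
  "sup_type_II_error N \<sigma> b a p R \<alpha> r =
     (\<Squnion>\<theta>\<in>{\<theta> \<in> ellipsoid N a p R. (\<Sum>j = 1..N. (\<theta> j)\<^sup>2) \<ge> r}.
        emeasure (law_Y N \<sigma> b \<theta>)
          {y \<in> space (law_Y N \<sigma> b \<theta>). test_dagger N (noise_level \<sigma> b) a p R \<alpha> y = 0})"

text \<open>Well-definedness: the laws are probability measures and the acceptance region is measurable.\<close>

lemma prob_space_std_noise: "prob_space (std_noise N)"
  unfolding std_noise_def
  by (intro prob_space_PiM prob_space_normal_density) simp

lemma measurable_observe_Y:
  "observe_Y N \<sigma> b \<theta> \<in> std_noise N \<rightarrow>\<^sub>M (\<Pi>\<^sub>M j\<in>{1..N}. borel)"
proof -
  have "(\<lambda>\<epsilon>. \<epsilon> j) \<in> borel_measurable (std_noise N)" if "j \<in> {1..N}" for j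
    using measurable_component_singleton[OF that, of "\<lambda>_. std_normal_distribution"]
    unfolding std_noise_def by simp
  then show ?thesis
    unfolding observe_Y_def observe_Z_def
    by (intro measurable_restrict borel_measurable_times borel_measurable_add
        borel_measurable_const)
qed

lemma prob_space_law_Y: "prob_space (law_Y N \<sigma> b \<theta>)"
  unfolding law_Y_def
  by (rule prob_space.prob_space_distr[OF prob_space_std_noise measurable_observe_Y])

lemma D_dagger_mem:
  assumes "N \<ge> 1"
  shows "D_dagger N s a p R \<in> {1..N}"
proof (cases "{D \<in> {1..N}. bias_sq a p R D \<le> rho_sqrt_sq s D} = {}")
  case True
  then show ?thesis using assms by (auto simp: D_dagger_def Let_def)
next
  case False
  then have "D_dagger N s a p R \<in> {D \<in> {1..N}. bias_sq a p R D \<le> rho_sqrt_sq s D}"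
    using Inf_nat_def1[OF False] by (simp add: D_dagger_def Let_def)
  then show ?thesis by blast
qed

lemma test_dagger_eq_0_iff:
  "test_dagger N s a p R \<alpha> y = 0 \<longleftrightarrow>
     (\<forall>j\<in>{D_dagger N s a p R + 1..N}.
        \<bar>y j\<bar> < q_coord s j (3 * \<alpha> / (pi\<^sup>2 * (real (j - D_dagger N s a p R))\<^sup>2))) \<and>
     (\<Sum>j = 1..D_dagger N s a p R. (y j)\<^sup>2) \<le> t_sum s (D_dagger N s a p R) (1 - \<alpha> / 2)"
proof -
  have Sup_0: "Sup (f ` A) = 0 \<longleftrightarrow> (\<forall>j\<in>A. f j = 0)" if "finite A" for A :: "nat set" and f :: "nat \<Rightarrow> nat"
  proof (cases "A = {}")
    case False
    with that have "Sup (f ` A) = Max (f ` A)" by (intro cSup_eq_Max) auto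
    then show ?thesis using that False Max_eq_iff[of "f ` A" 0] by auto
  qed simp
  have max_0: "max m n = 0 \<longleftrightarrow> m = 0 \<and> n = 0" for m n :: nat
    by (auto simp: max_def)
  show ?thesis
    by (simp only: test_dagger_def max_0 test_loc_def test_coord_def test_sum_def Sup_0
        finite_atLeastAtMost of_bool_eq_0_iff not_le not_less)
qed

lemma sets_acceptance_region:
  assumes "N \<ge> 1"
  shows "{y \<in> space (law_Y N \<sigma> b \<theta>). test_dagger N s a p R \<alpha> y = 0} \<in> sets (law_Y N \<sigma> b \<theta>)"
proof -
  let ?M = "\<Pi>\<^sub>M j\<in>{1..N}. (borel :: real measure)"
  define D where "D = D_dagger N s a p R"
  have D: "D \<in> {1..N}" unfolding D_def by (rule D_dagger_mem[OF assms])
  have comp: "(\<lambda>y. y j) \<in> borel_measurable ?M" if "j \<in> {1..N}" for j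
    using measurable_component_singleton[OF that, of "\<lambda>_. borel"] .
  have sum: "(\<lambda>y. \<Sum>j = 1..D. (y j)\<^sup>2) \<in> borel_measurable ?M"
    using D by (intro borel_measurable_sum borel_measurable_power comp) auto
  have "{y \<in> space ?M. \<forall>j\<in>{D + 1..N}. \<bar>y j\<bar> < c j} \<in> sets ?M" for c
    using D
    by (intro sets.sets_Collect_finite_All borel_measurable_less borel_measurable_abs comp
        borel_measurable_const) auto
  moreover have "{y \<in> space ?M. (\<Sum>j = 1..D. (y j)\<^sup>2) \<le> d} \<in> sets ?M" for d
    by (intro borel_measurable_le sum borel_measurable_const)
  ultimately have "{y \<in> space ?M. (\<forall>j\<in>{D + 1..N}. \<bar>y j\<bar> < c j) \<and> (\<Sum>j = 1..D. (y j)\<^sup>2) \<le> d}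
      \<in> sets ?M" for c d
    by (intro sets.sets_Collect_conj)
  then show ?thesis
    unfolding test_dagger_eq_0_iff D_def[symmetric] law_Y_def by simp
qed

end

theory Submission
  imports Defs
begin

text \<open>
  Write \<open>D\<close> for \<open>D\<^sup>\<dagger>\<close>, \<open>s j\<close> for the standard deviation of \<open>Y j\<close>, \<open>r\<close> for the rate \<open>\<rho>\<^sup>2\<close> of the
  theorem, and \<open>\<rho> n\<close>, \<open>bias n\<close> for the two squared terms of which \<open>r\<close> is the largest minimum over \<open>n\<close>.
  Since \<open>D\<close> is the first index at which the bias is at most \<open>\<rho>\<close>, or \<open>N\<close> if there is none, the rate
  dominates \<open>\<rho> (D - 1)\<close>, and it dominates \<open>bias D\<close> as soon as there are coordinates beyond \<open>D\<close>.

  Let \<open>\<theta>\<close> be a parameter for which the error exceeds \<open>\<beta>\<close>.  Both parts of the test miss it, and each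
  miss bounds a part of the energy of \<open>\<theta>\<close>.

  \<^item> By Chebyshev's inequality, applied once to bound the critical value and once under \<open>\<theta>\<close>, the
    energy of the first \<open>D\<close> coordinates is at most a constant times the square root of
    \<open>\<Sum>j\<le>D. s j ^ 4\<close> (\<open>type_II_error_sum\<close>).

  \<^item> By a Gaussian tail bound, \<open>\<bar>\<theta> j\<bar> \<le> T * s j\<close> for \<open>j > D\<close>, where \<open>T\<^sup>2\<close> is proportional to \<open>ln N\<close>
    (\<open>type_II_error_coord\<close>).  Then \<open>(\<theta> j)\<^sup>2 \<le> \<bar>\<theta> j\<bar> powr p * (T * s j) powr (2 - p)\<close>, and the ellipsoid
    condition together with the monotonicity of \<open>a j powr (- p) * b j powr (- (2 - p))\<close> bounds the sum
    over \<open>j > D\<close> by its weight at \<open>D\<close>.  The result is the geometric mean, with exponents \<open>p / 2\<close> and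
    \<open>1 - p / 2\<close>, of \<open>bias D\<close> and \<open>sqrt D * (s D)\<^sup>2\<close>, up to a power of \<open>T\<close> (\<open>tail_energy_le\<close>).

  It remains to compare the noise up to \<open>D\<close> with \<open>\<rho> (D - 1)\<close>.  If the noise grows polynomially, a
  window that starts at the median shows that \<open>\<rho> (D - 1)\<close> is at least of the order \<open>sqrt D * (s D)\<^sup>2\<close>,
  and this is also the order of the root of the sum of fourth powers.  If it grows exponentially, the largest
  term alone gives a lower bound of the order \<open>(s D)\<^sup>2\<close>, which is the order of the root of the sum, but falls short of
  \<open>sqrt D * (s D)\<^sup>2\<close> by \<open>sqrt D\<close>; with the exponent \<open>1 - p / 2\<close> this is the additional factor of the
  severely ill-posed case.

  For \<open>D = 1\<close> there is no index \<open>D - 1\<close>; in this case \<open>bias 1 = (R / a 1)\<^sup>2\<close> is at most \<open>r\<close>, and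
  no parameter of the ellipsoid has a larger squared norm, so that with \<open>C ln N > 1\<close> the supremum is over the empty set.
\<close>


section \<open>Gaussian tails and quantiles\<close>

text \<open>
  Splitting the exponent of the density into two halves gives the exponential decay with a crude
  rate; only the order \<open>sqrt (ln (1 / u))\<close> of the resulting quantiles matters below.
\<close>

lemma normal_tail:
  fixes s x :: real
  assumes "s > 0" "x \<ge> 0"
  shows "measure (density lborel (normal_density 0 s)) {y. s * x \<le> \<bar>y\<bar>} \<le> sqrt 2 * exp (- (x\<^sup>2 / 4))"
proof -
  interpret prob_space "density lborel (normal_density 0 s)"
    using assms by (intro prob_space_normal_density)
  let ?c = "sqrt 2 * exp (- (x\<^sup>2 / 4))"
  \<comment> \<open>Where \<open>\<bar>y\<bar> \<ge> s x\<close>, half of the exponent is at most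
      \<open>- x\<^sup>2 / 4\<close>; the other half belongs, up to the factor \<open>sqrt 2\<close>, to
      a Gaussian density of twice the variance.\<close>
  have pt: "normal_density 0 s y * indicator {y. s * x \<le> \<bar>y\<bar>} y \<le> ?c * normal_density 0 (sqrt 2 * s) y"
    for y
  proof (cases "s * x \<le> \<bar>y\<bar>")
    case True
    then have "(s * x)\<^sup>2 \<le> y\<^sup>2" using assms abs_le_square_iff[of "s * x" y] by simp
    then have le: "x\<^sup>2 / 4 \<le> y\<^sup>2 / (4 * s\<^sup>2)" using assms by (simp add: field_simps power_mult_distrib)
    have "exp (- y\<^sup>2 / (2 * s\<^sup>2)) \<le> exp (- (x\<^sup>2 / 4)) * exp (- y\<^sup>2 / (4 * s\<^sup>2))"
      unfolding exp_add[symmetric] using le by (simp add: field_simps)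
    then have "2 * exp (- y\<^sup>2 / (2 * s\<^sup>2))
        \<le> sqrt 2 * (sqrt 2 * (exp (- (x\<^sup>2 / 4)) * exp (- y\<^sup>2 / (4 * s\<^sup>2))))"
      by (simp flip: mult.assoc)
    then show ?thesis
      using True assms by (simp add: normal_density_def real_sqrt_mult power_mult_distrib field_simps)
  next
    case False
    then show ?thesis by (simp add: normal_density_nonneg)
  qed
  have "emeasure (density lborel (normal_density 0 s)) {y. s * x \<le> \<bar>y\<bar>}
      = (\<integral>\<^sup>+y. ennreal (normal_density 0 s y * indicator {y. s * x \<le> \<bar>y\<bar>} y) \<partial>lborel)"
    by (subst emeasure_density) (auto intro!: nn_integral_cong simp: ennreal_indicator[symmetric] ennreal_mult'
        normal_density_nonneg split: split_indicator)
  also have "\<dots> \<le> (\<integral>\<^sup>+y. ennreal (?c * normal_density 0 (sqrt 2 * s) y) \<partial>lborel)"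
    using pt by (intro nn_integral_mono ennreal_leI)
  also have "\<dots> = ennreal (\<integral>y. ?c * normal_density 0 (sqrt 2 * s) y \<partial>lborel)"
    using assms by (intro nn_integral_eq_integral) (auto simp: normal_density_nonneg)
  also have "(\<integral>y. ?c * normal_density 0 (sqrt 2 * s) y \<partial>lborel) = ?c"
    using assms by simp
  finally show ?thesis
    by (simp add: emeasure_eq_measure)
qed

text \<open>
  The solution of \<open>sqrt 2 * exp (- (x\<^sup>2 / 4)) = u\<close>, an upper bound for the two-sided standard Gaussian
  quantile of level \<open>u\<close>.
\<close>

definition tail_width :: "real \<Rightarrow> real" where
  "tail_width u = 2 * sqrt (ln (sqrt 2 / u))"

lemma tail_width_nonneg: "0 < u \<Longrightarrow> u \<le> 1 \<Longrightarrow> 0 \<le> tail_width u"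
  by (simp add: tail_width_def ln_ge_zero_iff field_simps order.trans[of u 1 "sqrt 2"])

lemma normal_tail_width:
  assumes "s > 0" "0 < u" "u \<le> 1"
  shows "measure (density lborel (normal_density 0 s)) {y. s * tail_width u \<le> \<bar>y\<bar>} \<le> u"
proof -
  have "1 \<le> sqrt 2 / u" using assms by (simp add: field_simps order.trans[of u 1 "sqrt 2"])
  then have "0 \<le> ln (sqrt 2 / u)" by simp
  then have "(tail_width u)\<^sup>2 / 4 = ln (sqrt 2 / u)"
    by (simp add: tail_width_def power_mult_distrib)
  moreover have "sqrt 2 * exp (- ln (sqrt 2 / u)) = u"
    using assms by (simp add: exp_minus)
  ultimately show ?thesis
    using normal_tail[OF assms(1) tail_width_nonneg[OF assms(2,3)]] by simp
qed

text \<open>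
  The levels of the coordinate tests decay only like \<open>1 / i\<^sup>2\<close>, with \<open>i \<le> N\<close>, and the width depends on the
  logarithm of the level: this is where the factor \<open>ln N\<close> of the theorem comes from.  The bound
  \<open>W \<ge> 2\<close> ensures \<open>W\<^sup>2 * ln N \<ge> 1\<close>.
\<close>

lemma tail_width_level_bound:
  assumes "0 < \<alpha>" "\<alpha> < 1" "0 < \<beta>" "\<beta> < 1"
  obtains W :: real where "W \<ge> 2"
    "\<And>N i :: nat. 2 \<le> N \<Longrightarrow> i \<in> {1..N} \<Longrightarrow>
       tail_width (3 * \<alpha> / (pi\<^sup>2 * (real i)\<^sup>2)) + tail_width \<beta> \<le> W * sqrt (ln (real N))"
proof
  define \<kappa> where "\<kappa> = \<bar>ln (sqrt 2 * pi\<^sup>2 / (3 * \<alpha>))\<bar>"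
  define W where "W = 2 + 2 * sqrt (2 * \<kappa> + 2) + 2 * tail_width \<beta>"
  have tw: "0 \<le> tail_width \<beta>" using assms by (intro tail_width_nonneg) auto
  have \<kappa>: "0 \<le> \<kappa>" by (simp add: \<kappa>_def)
  show "W \<ge> 2" unfolding W_def using tw \<kappa> by auto
  fix N i :: nat assume N: "2 \<le> N" and i: "i \<in> {1..N}"
  have "ln 2 \<le> ln (real N)" using N by simp
  then have lnN: "1 / 2 \<le> ln (real N)" using ln2_ge_two_thirds by simp
  have sq: "1 / 2 \<le> sqrt (ln (real N))"
    by (rule real_le_rsqrt) (use lnN in \<open>simp add: power2_eq_square\<close>)
  have "ln (sqrt 2 / (3 * \<alpha> / (pi\<^sup>2 * (real i)\<^sup>2))) = ln ((sqrt 2 * pi\<^sup>2 / (3 * \<alpha>)) * (real i)\<^sup>2)"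
    by (simp add: mult_ac)
  also have "\<dots> = ln (sqrt 2 * pi\<^sup>2 / (3 * \<alpha>)) + 2 * ln (real i)"
    using assms i by (subst ln_mult) (auto simp: ln_realpow)
  also have "\<dots> \<le> \<kappa> + 2 * ln (real N)"
    using i by (intro add_mono mult_left_mono) (auto simp: \<kappa>_def)
  also have "\<dots> \<le> (2 * \<kappa> + 2) * ln (real N)"
    using mult_left_mono[OF lnN \<kappa>] by (simp add: algebra_simps)
  finally have "tail_width (3 * \<alpha> / (pi\<^sup>2 * (real i)\<^sup>2)) \<le> 2 * sqrt ((2 * \<kappa> + 2) * ln (real N))"
    unfolding tail_width_def by simp
  also have "\<dots> = 2 * sqrt (2 * \<kappa> + 2) * sqrt (ln (real N))" by (simp add: real_sqrt_mult)
  finally have "tail_width (3 * \<alpha> / (pi\<^sup>2 * (real i)\<^sup>2)) + tail_width \<beta>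
      \<le> 2 * sqrt (2 * \<kappa> + 2) * sqrt (ln (real N)) + 2 * tail_width \<beta> * sqrt (ln (real N))"
    using mult_left_mono[OF sq tw] by simp
  also have "\<dots> \<le> W * sqrt (ln (real N))"
  proof -
    have "W * sqrt (ln (real N)) = 2 * sqrt (ln (real N))
        + 2 * sqrt (2 * \<kappa> + 2) * sqrt (ln (real N)) + 2 * tail_width \<beta> * sqrt (ln (real N))"
      by (simp only: W_def distrib_right)
    then show ?thesis using sq by linarith
  qed
  finally show "tail_width (3 * \<alpha> / (pi\<^sup>2 * (real i)\<^sup>2)) + tail_width \<beta> \<le> W * sqrt (ln (real N))" .
qed

text \<open>
  Nonnegativity and \<open>u < 1\<close> bound the set whose infimum is the quantile from below by \<open>0\<close>; only then
  is the infimum known to be at most each of its elements.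
\<close>

lemma quantile_distr_le:
  fixes f :: "'a \<Rightarrow> real"
  assumes "prob_space M" and f [measurable]: "f \<in> borel_measurable M"
    and nonneg: "\<And>\<omega>. \<omega> \<in> space M \<Longrightarrow> 0 \<le> f \<omega>"
    and x: "measure M {\<omega> \<in> space M. x \<le> f \<omega>} \<le> u" and "u < 1"
  shows "quantile (distr M borel f) (1 - u) \<le> x"
proof -
  interpret prob_space M by fact
  have cdf: "cdf (distr M borel f) y = measure M {\<omega> \<in> space M. f \<omega> \<le> y}" for y
    by (simp add: cdf_def measure_distr vimage_def Int_def conj_commute)
  have "1 - u \<le> 1 - measure M {\<omega> \<in> space M. x \<le> f \<omega>}" using x by simp
  also have "\<dots> = measure M {\<omega> \<in> space M. \<not> x \<le> f \<omega>}"
    by (subst prob_neg) auto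
  also have "\<dots> \<le> measure M {\<omega> \<in> space M. f \<omega> \<le> x}"
    by (intro finite_measure_mono) auto
  finally have mem: "x \<in> {y. 1 - u \<le> cdf (distr M borel f) y}" by (simp add: cdf)
  have "0 \<le> y" if "1 - u \<le> cdf (distr M borel f) y" for y
  proof (rule ccontr)
    assume "\<not> 0 \<le> y"
    then have "{\<omega> \<in> space M. f \<omega> \<le> y} = {}" using nonneg by force
    then have "cdf (distr M borel f) y = 0" by (simp only: cdf measure_empty)
    then show False using that \<open>u < 1\<close> by simp
  qed
  then have "bdd_below {y. 1 - u \<le> cdf (distr M borel f) y}" by (intro bdd_belowI[of _ 0]) auto
  then show ?thesis unfolding quantile_def by (rule cInf_lower[OF mem])
qed

lemma q_coord_le:
  assumes "s j > 0" "0 < u" "u < 1"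
  shows "q_coord s j u \<le> s j * tail_width u"
  unfolding q_coord_def
  using assms normal_tail_width[of "s j" u]
  by (intro quantile_distr_le prob_space_normal_density) auto


section \<open>Quadratic functionals of the noise\<close>

text \<open>
  Independent centred variables are orthogonal, so the second moments add up.
\<close>

lemma PiM_sum_second_moment:
  fixes f :: "'i \<Rightarrow> 'a \<Rightarrow> real"
  assumes "finite I" and "\<And>i. prob_space (M i)" and A: "A \<subseteq> I"
    and f: "\<And>i. i \<in> A \<Longrightarrow> integrable (M i) (f i)"
    and f2: "\<And>i. i \<in> A \<Longrightarrow> integrable (M i) (\<lambda>x. (f i x)\<^sup>2)"
    and centred: "\<And>i. i \<in> A \<Longrightarrow> (\<integral>x. f i x \<partial>M i) = 0"
  shows "integrable (Pi\<^sub>M I M) (\<lambda>x. (\<Sum>i\<in>A. f i (x i))\<^sup>2)"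
    and "(\<integral>x. (\<Sum>i\<in>A. f i (x i))\<^sup>2 \<partial>Pi\<^sub>M I M) = (\<Sum>i\<in>A. \<integral>x. (f i x)\<^sup>2 \<partial>M i)"
proof -
  interpret product_prob_space M I
    using assms(2) by (simp add: product_prob_space_def product_prob_space_axioms_def
        product_sigma_finite_def prob_space_imp_sigma_finite)
  have finA: "finite A" using assms(1) A by (rule rev_finite_subset)
  \<comment> \<open>Each product of two terms is written as a product over all coordinates, so that
      Fubini applies to it.\<close>
  define g where "g i j k = (if k = i \<and> k = j then (\<lambda>x. (f k x)\<^sup>2)
      else if k = i \<or> k = j then f k else (\<lambda>_. 1))" for i j k
  have g_int: "integrable (M k) (g i j k)" if "i \<in> A" "j \<in> A" for i j k
    using f f2 that by (auto simp: g_def)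
  have g_prod: "(\<Prod>k\<in>I. g i j k (x k)) = f i (x i) * f j (x j)"
    if "i \<in> A" "j \<in> A" for i j x
  proof -
    have "(\<Prod>k\<in>I. g i j k (x k)) = (\<Prod>k\<in>{i, j}. g i j k (x k))"
      using that A assms(1) by (intro prod.mono_neutral_right) (auto simp: g_def)
    then show ?thesis by (cases "i = j") (auto simp: g_def power2_eq_square)
  qed
  have g_integral: "(\<Prod>k\<in>I. \<integral>x. g i j k x \<partial>M k) = (if i = j then \<integral>x. (f i x)\<^sup>2 \<partial>M i else 0)"
    if "i \<in> A" "j \<in> A" for i j
  proof -
    have "(\<Prod>k\<in>I. \<integral>x. g i j k x \<partial>M k) = (\<Prod>k\<in>{i, j}. \<integral>x. g i j k x \<partial>M k)"
      using that A assms(1)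
      by (intro prod.mono_neutral_right) (auto simp: g_def prob_space.prob_space[OF assms(2)])
    then show ?thesis using centred that by (auto simp: g_def)
  qed
  have int: "integrable (Pi\<^sub>M I M) (\<lambda>x. f i (x i) * f j (x j))" if "i \<in> A" "j \<in> A" for i j
    using product_integrable_prod[OF assms(1) g_int[OF that]] by (simp add: g_prod[OF that])
  have val: "(\<integral>x. f i (x i) * f j (x j) \<partial>Pi\<^sub>M I M) = (if i = j then \<integral>x. (f i x)\<^sup>2 \<partial>M i else 0)"
    if "i \<in> A" "j \<in> A" for i j
    using product_integral_prod[OF assms(1) g_int[OF that]]
    by (simp add: g_prod[OF that] g_integral[OF that])
  have expand: "(\<Sum>i\<in>A. f i (x i))\<^sup>2 = (\<Sum>i\<in>A. \<Sum>j\<in>A. f i (x i) * f j (x j))" for x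
    by (simp add: power2_eq_square sum_product)
  show "integrable (Pi\<^sub>M I M) (\<lambda>x. (\<Sum>i\<in>A. f i (x i))\<^sup>2)"
    unfolding expand by (intro Bochner_Integration.integrable_sum int)
  show "(\<integral>x. (\<Sum>i\<in>A. f i (x i))\<^sup>2 \<partial>Pi\<^sub>M I M) = (\<Sum>i\<in>A. \<integral>x. (f i x)\<^sup>2 \<partial>M i)"
    unfolding expand
    by (subst Bochner_Integration.integral_sum, intro Bochner_Integration.integrable_sum int, assumption+)
       (simp add: Bochner_Integration.integral_sum int val finA sum.delta')
qed

lemma std_normal_low_moments:
  shows "(\<integral>x. x \<partial>std_normal_distribution) = 0" "(\<integral>x. x\<^sup>2 \<partial>std_normal_distribution) = 1"
    "(\<integral>x. x^3 \<partial>std_normal_distribution) = 0" "(\<integral>x. x^4 \<partial>std_normal_distribution) = 3"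
  using integral_std_normal_distribution_moment_odd[of 1]
    integral_std_normal_distribution_moment_odd[of 3]
    std_normal_distribution_even_moments(1)[of 1] std_normal_distribution_even_moments(1)[of 2]
  by (simp_all add: fact_numeral)

lemma shifted_square_moments:
  fixes t s :: real
  defines "f \<equiv> \<lambda>x. (t + s * x)\<^sup>2 - t\<^sup>2 - s\<^sup>2"
  shows "integrable std_normal_distribution f"
    "integrable std_normal_distribution (\<lambda>x. (f x)\<^sup>2)"
    "(\<integral>x. f x \<partial>std_normal_distribution) = 0"
    "(\<integral>x. (f x)\<^sup>2 \<partial>std_normal_distribution) = 4 * t\<^sup>2 * s\<^sup>2 + 2 * s^4"
proof -
  interpret prob_space std_normal_distribution by (rule prob_space_normal_density) simp
  note int [simp] = integrable_std_normal_distribution_moment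
  have int1 [simp]: "integrable std_normal_distribution (\<lambda>x. x)" using int[of 1] by simp
  have f: "f = (\<lambda>x. 2 * t * s * x + s\<^sup>2 * x\<^sup>2 - s\<^sup>2)"
    by (auto simp: f_def fun_eq_iff power2_eq_square algebra_simps)
  have f2: "(\<lambda>x. (f x)\<^sup>2) = (\<lambda>x. s^4 * x^4 + 4 * t * s^3 * x^3 + (4 * t\<^sup>2 * s\<^sup>2 - 2 * s^4) * x\<^sup>2
      - 4 * t * s^3 * x + s^4)"
    by (auto simp: f fun_eq_iff eval_nat_numeral algebra_simps)
  show "integrable std_normal_distribution f" unfolding f by simp
  show "integrable std_normal_distribution (\<lambda>x. (f x)\<^sup>2)" unfolding f2 by simp
  show "(\<integral>x. f x \<partial>std_normal_distribution) = 0"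
    unfolding f by (simp add: std_normal_low_moments prob_space[simplified])
  show "(\<integral>x. (f x)\<^sup>2 \<partial>std_normal_distribution) = 4 * t\<^sup>2 * s\<^sup>2 + 2 * s^4"
    unfolding f2 by (simp add: std_normal_low_moments prob_space[simplified])
qed

text \<open>
  Chebyshev's inequality for \<open>\<Sum>j. (Y j)\<^sup>2\<close>, under an arbitrary parameter; \<open>\<theta> = 0\<close> gives the null
  distribution, which defines the critical value.
\<close>

lemma std_noise_quadratic_deviation:
  fixes \<theta> s :: "nat \<Rightarrow> real"
  assumes A: "A \<subseteq> {1..N}" and x: "x > 0"
  shows "measure (std_noise N) {\<epsilon> \<in> space (std_noise N).
           x \<le> \<bar>(\<Sum>j\<in>A. (\<theta> j + s j * \<epsilon> j)\<^sup>2) - (\<Sum>j\<in>A. (\<theta> j)\<^sup>2) - (\<Sum>j\<in>A. (s j)\<^sup>2)\<bar>}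
         \<le> (\<Sum>j\<in>A. 4 * (\<theta> j)\<^sup>2 * (s j)\<^sup>2 + 2 * s j ^ 4) / x\<^sup>2"
proof -
  interpret prob_space "std_noise N" by (rule prob_space_std_noise)
  define f where "f j = (\<lambda>y. (\<theta> j + s j * y)\<^sup>2 - (\<theta> j)\<^sup>2 - (s j)\<^sup>2)" for j
  have F: "(\<Sum>j\<in>A. (\<theta> j + s j * \<epsilon> j)\<^sup>2) - (\<Sum>j\<in>A. (\<theta> j)\<^sup>2) - (\<Sum>j\<in>A. (s j)\<^sup>2)
      = (\<Sum>j\<in>A. f j (\<epsilon> j))" for \<epsilon>
    by (simp add: f_def sum_subtractf)
  have P: "\<And>i::nat. prob_space std_normal_distribution"
    by (rule prob_space_normal_density) simp
  note sm = PiM_sum_second_moment[OF finite_atLeastAtMost[of 1 N] P A, of f]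
  have int: "integrable (std_noise N) (\<lambda>\<epsilon>. (\<Sum>j\<in>A. f j (\<epsilon> j))\<^sup>2)"
    unfolding std_noise_def by (rule sm) (simp_all add: f_def shifted_square_moments)
  have val: "(\<integral>\<epsilon>. (\<Sum>j\<in>A. f j (\<epsilon> j))\<^sup>2 \<partial>std_noise N) = (\<Sum>j\<in>A. 4 * (\<theta> j)\<^sup>2 * (s j)\<^sup>2 + 2 * s j ^ 4)"
    unfolding std_noise_def
    by (subst sm(2)) (simp_all add: f_def shifted_square_moments)
  have "(x \<le> \<bar>z\<bar>) = (x\<^sup>2 \<le> z\<^sup>2)" for z
    using x abs_le_square_iff[of x z] by auto
  then show ?thesis
    using integral_Markov_inequality_measure[OF int, of "{}" "x\<^sup>2"] x
    by (simp add: F val)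
qed

lemma measurable_std_noise_component [measurable]:
  "j \<in> {1..N} \<Longrightarrow> (\<lambda>\<epsilon>. \<epsilon> j) \<in> borel_measurable (std_noise N)"
  using measurable_component_singleton[of j "{1..N}" "\<lambda>_. std_normal_distribution"]
  unfolding std_noise_def by simp

lemma t_sum_le:
  assumes s: "\<And>j. j \<in> {1..D} \<Longrightarrow> s j > 0" and "1 \<le> D" and "0 < u" "u < 1"
  shows "t_sum s D (1 - u) \<le> (\<Sum>j=1..D. (s j)\<^sup>2) + sqrt (2 / u) * sqrt (\<Sum>j=1..D. s j ^ 4)"
proof -
  define S where "S = (\<Sum>j=1..D. s j ^ 4)"
  have S: "S > 0" unfolding S_def using \<open>1 \<le> D\<close> by (intro sum_pos zero_less_power s) auto
  let ?x = "sqrt (2 / u) * sqrt S"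
  have x: "0 < ?x" using S assms by simp
  interpret prob_space "std_noise D" by (rule prob_space_std_noise)
  have dev: "measure (std_noise D) {\<epsilon> \<in> space (std_noise D).
      ?x \<le> \<bar>(\<Sum>j=1..D. (s j)\<^sup>2 * (\<epsilon> j)\<^sup>2) - (\<Sum>j=1..D. (s j)\<^sup>2)\<bar>} \<le> (\<Sum>j=1..D. 2 * s j ^ 4) / ?x\<^sup>2"
    using std_noise_quadratic_deviation[OF order.refl x, where \<theta> = "\<lambda>_. 0" and s = s]
    by (simp add: power_mult_distrib)
  have "(\<Sum>j=1..D. 2 * s j ^ 4) / ?x\<^sup>2 = u"
  proof -
    have "(\<Sum>j=1..D. 2 * s j ^ 4) = 2 * S" by (simp add: S_def sum_distrib_left)
    then show ?thesis using S assms by (simp add: power_mult_distrib)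
  qed
  then have "measure (std_noise D) {\<epsilon> \<in> space (std_noise D).
      (\<Sum>j=1..D. (s j)\<^sup>2) + ?x \<le> (\<Sum>j=1..D. (s j)\<^sup>2 * (\<epsilon> j)\<^sup>2)} \<le> u"
    by (intro order.trans[OF finite_measure_mono dev[THEN order.trans]]) auto
  then show ?thesis
    unfolding t_sum_def S_def[symmetric] using assms
    by (intro quantile_distr_le prob_space_std_noise) (auto intro!: sum_nonneg)
qed


section \<open>What an undetected parameter satisfies\<close>

lemma observe_Y_eq:
  assumes "j \<in> {1..N}" "b j > 0"
  shows "observe_Y N \<sigma> b \<theta> \<epsilon> j = \<theta> j + noise_level \<sigma> b j * \<epsilon> j"
  using assms by (simp add: observe_Y_def observe_Z_def noise_level_def field_simps)

text \<open>
  Passes from the law of the observation to the noise, where the acceptance of the test is covered by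
  an event of known probability.
\<close>

lemma emeasure_law_Y_le:
  assumes "\<And>j. j \<in> {1..N} \<Longrightarrow> b j > 0"
    and E: "{\<epsilon> \<in> space (std_noise N). E \<epsilon>} \<in> sets (std_noise N)"
    and imp: "\<And>\<epsilon>. P (observe_Y N \<sigma> b \<theta> \<epsilon>) \<Longrightarrow> E \<epsilon>"
    and le: "measure (std_noise N) {\<epsilon> \<in> space (std_noise N). E \<epsilon>} \<le> \<beta>"
    and P: "{y \<in> space (law_Y N \<sigma> b \<theta>). P y} \<in> sets (law_Y N \<sigma> b \<theta>)"
  shows "emeasure (law_Y N \<sigma> b \<theta>) {y \<in> space (law_Y N \<sigma> b \<theta>). P y} \<le> ennreal \<beta>"
proof -
  interpret prob_space "std_noise N" by (rule prob_space_std_noise)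
  have "emeasure (law_Y N \<sigma> b \<theta>) {y \<in> space (law_Y N \<sigma> b \<theta>). P y}
     = emeasure (std_noise N) (observe_Y N \<sigma> b \<theta> -` {y \<in> space (law_Y N \<sigma> b \<theta>). P y} \<inter> space (std_noise N))"
    using P unfolding law_Y_def by (intro emeasure_distr measurable_observe_Y) simp
  also have "\<dots> \<le> emeasure (std_noise N) {\<epsilon> \<in> space (std_noise N). E \<epsilon>}"
    using imp by (intro emeasure_mono E) auto
  also have "\<dots> \<le> ennreal \<beta>" using le by (simp add: emeasure_eq_measure ennreal_leI)
  finally show ?thesis .
qed

definition type_II_error ::
  "nat \<Rightarrow> real \<Rightarrow> (nat \<Rightarrow> real) \<Rightarrow> (nat \<Rightarrow> real) \<Rightarrow> real \<Rightarrow> real \<Rightarrow> real \<Rightarrow> (nat \<Rightarrow> real) \<Rightarrow> ennreal" where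
  "type_II_error N \<sigma> b a p R \<alpha> \<theta> = emeasure (law_Y N \<sigma> b \<theta>)
     {y \<in> space (law_Y N \<sigma> b \<theta>). test_dagger N (noise_level \<sigma> b) a p R \<alpha> y = 0}"

text \<open>
  Under \<open>\<theta>\<close>, acceptance by the test on coordinate \<open>j\<close> forces the noise to make up for the distance
  between \<open>\<bar>\<theta> j\<bar>\<close> and the critical value, hence to exceed its own quantile of level \<open>\<beta>\<close>.
\<close>

lemma type_II_error_coord:
  fixes N \<sigma> b a p R
  defines "s \<equiv> noise_level \<sigma> b"
  defines "D \<equiv> D_dagger N s a p R"
  assumes "\<sigma> > 0" and b: "\<And>j. j \<in> {1..N} \<Longrightarrow> b j > 0" and "0 < \<alpha>" "\<alpha> < 1" "0 < \<beta>" "\<beta> < 1"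
    and j: "j \<in> {D+1..N}"
    and big: "s j * (tail_width (3 * \<alpha> / (pi\<^sup>2 * (real (j - D))\<^sup>2)) + tail_width \<beta>) \<le> \<bar>\<theta> j\<bar>"
  shows "type_II_error N \<sigma> b a p R \<alpha> \<theta> \<le> ennreal \<beta>"
proof -
  define u where "u = 3 * \<alpha> / (pi\<^sup>2 * (real (j - D))\<^sup>2)"
  have N: "1 \<le> N" and jN: "j \<in> {1..N}" using j by auto
  have sj: "s j > 0" using b[OF jN] \<open>\<sigma> > 0\<close> by (simp add: s_def noise_level_def)
  have "1 \<le> real (j - D)" using j by auto
  then have "1 \<le> (real (j - D))\<^sup>2" by simp
  moreover have "3 < pi\<^sup>2" using power_strict_mono[of 3 pi 2] pi_gt3 by simp
  ultimately have "3 < pi\<^sup>2 * (real (j - D))\<^sup>2" 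
    using mult_left_mono[of 1 "(real (j - D))\<^sup>2" "pi\<^sup>2"] by linarith
  then have u: "0 < u" "u < 1"
    using assms unfolding u_def by (auto simp: field_simps)
  have q: "q_coord s j u \<le> s j * tail_width u" using q_coord_le[of s j u] sj u by simp
  have "measure (std_noise N) {\<epsilon> \<in> space (std_noise N). tail_width \<beta> \<le> \<bar>\<epsilon> j\<bar>}
      = measure std_normal_distribution {y. tail_width \<beta> \<le> \<bar>y\<bar>}"
  proof -
    have "distr (std_noise N) std_normal_distribution (\<lambda>\<epsilon>. \<epsilon> j) = std_normal_distribution"
      unfolding std_noise_def using jN
      by (intro distr_PiM_component prob_space_normal_density) auto
    then have "measure std_normal_distribution {y. tail_width \<beta> \<le> \<bar>y\<bar>}
      = measure (distr (std_noise N) std_normal_distribution (\<lambda>\<epsilon>. \<epsilon> j)) {y. tail_width \<beta> \<le> \<bar>y\<bar>}"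
      by simp
    also have "\<dots> = measure (std_noise N) {\<epsilon> \<in> space (std_noise N). tail_width \<beta> \<le> \<bar>\<epsilon> j\<bar>}"
      using jN by (subst measure_distr) (auto intro!: arg_cong[where f="measure _"])
    finally show ?thesis by simp
  qed
  also have "\<dots> \<le> \<beta>" using normal_tail_width[of 1 \<beta>] assms by simp
  finally have le: "measure (std_noise N) {\<epsilon> \<in> space (std_noise N). tail_width \<beta> \<le> \<bar>\<epsilon> j\<bar>} \<le> \<beta>" .
  show ?thesis
    unfolding type_II_error_def
  proof (rule emeasure_law_Y_le[OF b _ _ le sets_acceptance_region[OF N]])
    show "{\<epsilon> \<in> space (std_noise N). tail_width \<beta> \<le> \<bar>\<epsilon> j\<bar>} \<in> sets (std_noise N)"
      using jN by measurable
    fix \<epsilon> assume "test_dagger N (noise_level \<sigma> b) a p R \<alpha> (observe_Y N \<sigma> b \<theta> \<epsilon>) = 0"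
    then have "\<bar>\<theta> j + s j * \<epsilon> j\<bar> < q_coord s j u"
      using j observe_Y_eq[of j N b \<sigma> \<theta> \<epsilon>, OF jN b[OF jN]]
      unfolding test_dagger_eq_0_iff s_def[symmetric] D_def[symmetric] u_def by metis
    then have "\<bar>\<theta> j + s j * \<epsilon> j\<bar> \<le> s j * tail_width u" using q by simp
    moreover have "s j * tail_width u + s j * tail_width \<beta> \<le> \<bar>\<theta> j\<bar>"
      using big by (simp add: u_def distrib_left)
    ultimately have "s j * tail_width \<beta> \<le> \<bar>s j * \<epsilon> j\<bar>" by linarith
    then show "tail_width \<beta> \<le> \<bar>\<epsilon> j\<bar>" using sj by (simp add: abs_mult)
  qed
qed

text \<open>
  Let \<open>\<Theta>\<close> be the energy of the first \<open>D\<close> coordinates.  The variance of the statistic is at most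
  \<open>2 * S\<^sup>2 + 4 * \<Theta> * S\<close>, of smaller order than \<open>\<Theta>\<^sup>2\<close> when \<open>\<Theta>\<close> is a large multiple of \<open>S\<close>.  The first summand
  of the constant covers the critical value, the second one makes the Chebyshev bound at most \<open>\<beta>\<close>.
\<close>

lemma type_II_error_sum:
  fixes N \<sigma> b a p R
  defines "s \<equiv> noise_level \<sigma> b"
  defines "D \<equiv> D_dagger N s a p R"
  defines "S \<equiv> sqrt (\<Sum>j=1..D. s j ^ 4)"
  assumes "1 \<le> N" "\<sigma> > 0" and b: "\<And>j. j \<in> {1..N} \<Longrightarrow> b j > 0" and "0 < \<alpha>" "\<alpha> < 1" "0 < \<beta>" "\<beta> < 1"
    and big: "(2 * sqrt (4 / \<alpha>) + 24 / \<beta>) * S \<le> (\<Sum>j=1..D. (\<theta> j)\<^sup>2)"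
  shows "type_II_error N \<sigma> b a p R \<alpha> \<theta> \<le> ennreal \<beta>"
proof -
  have D: "D \<in> {1..N}" unfolding D_def by (rule D_dagger_mem[OF \<open>1 \<le> N\<close>])
  have s: "s j > 0" if "j \<in> {1..N}" for j
    using b[OF that] \<open>\<sigma> > 0\<close> by (simp add: s_def noise_level_def)
  define \<Theta> where "\<Theta> = (\<Sum>j=1..D. (\<theta> j)\<^sup>2)"
  have S4: "S\<^sup>2 = (\<Sum>j=1..D. s j ^ 4)" unfolding S_def by (simp add: sum_nonneg)
  have "S\<^sup>2 > 0" unfolding S4 using D by (intro sum_pos zero_less_power s) auto
  then have S: "S > 0" unfolding S_def by (auto simp: sum_nonneg order_less_le)
  have c: "24 / \<beta> > 0" "0 \<le> sqrt (4 / \<alpha>)" using assms by auto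
  have "24 / \<beta> * S \<le> \<Theta>" "2 * (sqrt (4 / \<alpha>) * S) \<le> \<Theta>"
  proof -
    have "24 / \<beta> * S \<le> (2 * sqrt (4 / \<alpha>) + 24 / \<beta>) * S" "2 * (sqrt (4 / \<alpha>) * S) \<le> (2 * sqrt (4 / \<alpha>) + 24 / \<beta>) * S"
      using S c by (auto simp: algebra_simps)
    then show "24 / \<beta> * S \<le> \<Theta>" "2 * (sqrt (4 / \<alpha>) * S) \<le> \<Theta>" using big unfolding \<Theta>_def by linarith+
  qed note \<Theta> = this
  have \<Theta>0: "\<Theta> > 0" using \<Theta>(1) c S by (meson less_le_trans mult_pos_pos)
  \<comment> \<open>The critical value uses up at most half of the signal; the other half has to be
      exceeded by a deviation.\<close>
  have tq: "t_sum s D (1 - \<alpha> / 2) \<le> (\<Sum>j=1..D. (s j)\<^sup>2) + sqrt (4 / \<alpha>) * S"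
    using t_sum_le[of D s "\<alpha> / 2"] D s assms unfolding S_def by auto
  have ssq: "(s j)\<^sup>2 \<le> S" if "j \<in> {1..D}" for j
  proof -
    have "s j ^ 4 \<le> (\<Sum>j=1..D. s j ^ 4)" using that by (intro member_le_sum) auto
    moreover have "((s j)\<^sup>2)\<^sup>2 = s j ^ 4" by simp
    ultimately have "((s j)\<^sup>2)\<^sup>2 \<le> S\<^sup>2" by (simp only: S4)
    then show ?thesis by (rule power2_le_imp_le) (use S in simp)
  qed
  have "(\<Sum>j=1..D. 4 * (\<theta> j)\<^sup>2 * (s j)\<^sup>2 + 2 * s j ^ 4) \<le> (\<Sum>j=1..D. 4 * (\<theta> j)\<^sup>2 * S + 2 * s j ^ 4)"
    using ssq by (intro sum_mono add_right_mono mult_left_mono) auto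
  also have "\<dots> = 4 * \<Theta> * S + 2 * S\<^sup>2"
    unfolding S4 \<Theta>_def by (simp add: sum.distrib sum_distrib_left sum_distrib_right)
  also have "\<dots> \<le> 6 * \<Theta> * S"
  proof -
    have "S \<le> 24 / \<beta> * S" using S assms by (simp add: field_simps)
    then have "S \<le> \<Theta>" using \<Theta> by simp
    then have "S * S \<le> \<Theta> * S" using S by simp
    then show ?thesis by (simp add: power2_eq_square mult_ac)
  qed
  also have "\<dots> \<le> \<beta> * (\<Theta> / 2)\<^sup>2"
  proof -
    have "24 * S \<le> \<beta> * \<Theta>" using \<Theta>(1) assms by (simp add: field_simps)
    then have "24 * S * \<Theta> \<le> \<beta> * \<Theta> * \<Theta>" using \<Theta>0 by simp
    then show ?thesis by (simp add: power2_eq_square mult_ac)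
  qed
  finally have var: "(\<Sum>j=1..D. 4 * (\<theta> j)\<^sup>2 * (s j)\<^sup>2 + 2 * s j ^ 4) / (\<Theta> / 2)\<^sup>2 \<le> \<beta>"
    using \<Theta>0 by (simp add: field_simps)
  let ?E = "\<lambda>\<epsilon>. \<Theta> / 2 \<le> \<bar>(\<Sum>j=1..D. (\<theta> j + s j * \<epsilon> j)\<^sup>2) - (\<Sum>j=1..D. (\<theta> j)\<^sup>2) - (\<Sum>j=1..D. (s j)\<^sup>2)\<bar>"
  have le: "measure (std_noise N) {\<epsilon> \<in> space (std_noise N). ?E \<epsilon>} \<le> \<beta>"
    using std_noise_quadratic_deviation[of "{1..D}" N "\<Theta> / 2" \<theta> s] D \<Theta>0 var by auto
  show ?thesis
    unfolding type_II_error_def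
  proof (rule emeasure_law_Y_le[OF b _ _ le sets_acceptance_region[OF \<open>1 \<le> N\<close>]])
    have [measurable]: "(\<lambda>\<epsilon>. \<epsilon> j) \<in> borel_measurable (std_noise N)" if "j \<in> {1..D}" for j
      using D that by (intro measurable_std_noise_component) auto
    show "{\<epsilon> \<in> space (std_noise N). ?E \<epsilon>} \<in> sets (std_noise N)" by measurable
    fix \<epsilon> assume "test_dagger N (noise_level \<sigma> b) a p R \<alpha> (observe_Y N \<sigma> b \<theta> \<epsilon>) = 0"
    then have "(\<Sum>j=1..D. (observe_Y N \<sigma> b \<theta> \<epsilon> j)\<^sup>2) \<le> t_sum s D (1 - \<alpha> / 2)"
      unfolding test_dagger_eq_0_iff s_def[symmetric] D_def[symmetric] by simp
    also have "(\<Sum>j=1..D. (observe_Y N \<sigma> b \<theta> \<epsilon> j)\<^sup>2) = (\<Sum>j=1..D. (\<theta> j + s j * \<epsilon> j)\<^sup>2)"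
      using D b by (intro sum.cong) (auto simp: observe_Y_eq s_def)
    finally show "?E \<epsilon>" using tq \<Theta>(2) unfolding \<Theta>_def by linarith
  qed
qed


section \<open>Lower bounds for the separation rate\<close>

text \<open>
  A nondecreasing minorant of \<open>s\<close> also minorizes the sorted values.  This gives access to the order
  statistics although the noise levels themselves need not be monotone.
\<close>

lemma order_stat_ge:
  assumes j: "j \<in> {1..n}" and w: "\<And>i. i \<in> {1..n} \<Longrightarrow> w i \<le> s i" and mono: "mono_on {1..n} w"
  shows "w j \<le> order_stat s n j"
proof (rule ccontr)
  define xs where "xs = map s [1..<Suc n]"
  let ?P = "\<lambda>x. x < w j"
  assume "\<not> w j \<le> order_stat s n j"
  then have less: "sort xs ! (j - 1) < w j" by (simp add: order_stat_def xs_def)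
  have len: "length xs = n" by (simp add: xs_def)
  \<comment> \<open>Sorting preserves the number of values below \<open>w j\<close>: at least
      \<open>j\<close> of them in the sorted list, while an index \<open>i\<close> with \<open>s i < w
      j\<close> satisfies \<open>i < j\<close>.\<close>
  have "{..<j} \<subseteq> {i. i < length (sort xs) \<and> ?P (sort xs ! i)}"
  proof
    fix i assume "i \<in> {..<j}"
    then have "i \<le> j - 1" "j - 1 < length (sort xs)" using j len by auto
    then have "sort xs ! i \<le> sort xs ! (j - 1)" by (intro sorted_nth_mono) auto
    then show "i \<in> {i. i < length (sort xs) \<and> ?P (sort xs ! i)}"
      using less \<open>i \<le> j - 1\<close> \<open>j - 1 < length (sort xs)\<close> by auto
  qed
  then have "card {..<j} \<le> card {i. i < length (sort xs) \<and> ?P (sort xs ! i)}"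
    by (intro card_mono) auto
  then have "j \<le> length (filter ?P (sort xs))" by (simp add: length_filter_conv_card)
  also have "\<dots> = length (filter ?P xs)"
    by (metis mset_filter mset_sort size_mset)
  also have "\<dots> = card {i. i < n \<and> ?P (xs ! i)}" by (simp add: length_filter_conv_card len)
  also have "\<dots> \<le> card {..<j - 1}"
  proof (intro card_mono subsetI)
    fix i assume "i \<in> {i. i < n \<and> ?P (xs ! i)}"
    then have i: "i < n" "s (Suc i) < w j" by (auto simp: xs_def simp del: upt_Suc)
    have "Suc i < j"
    proof (rule ccontr)
      assume "\<not> Suc i < j"
      then have "w j \<le> w (Suc i)" using i j by (intro mono_onD[OF mono]) auto
      then show False using i w[of "Suc i"] by simp
    qed
    then show "i \<in> {..<j - 1}" by auto
  qed simp
  finally have "j \<le> j - 1" by simp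
  then show False using j by simp linarith
qed

lemma rho_sq_ge_window:
  assumes "l \<le> n - k"
  shows "Sigma_sq s n l k * ln (1 + max (real (n - l) / (real k)\<^sup>2) (sqrt (real (n - l) / (real k)\<^sup>2)))
      \<le> rho_sq s k n"
  unfolding rho_sq_def using assms by (intro max.coboundedI1 Max_ge) auto

lemma rho_sq_ge_top:
  assumes "1 \<le> k" "1 \<le> n"
  shows "(order_stat s n n)\<^sup>2 \<le> rho_sq s k n"
proof -
  have "order_stat s n n ^ 4 \<le> (\<Sum>j = n - k + 1..n. order_stat s n j ^ 4)"
    using assms by (intro member_le_sum) auto
  then have "sqrt (order_stat s n n ^ 4) \<le> sqrt (\<Sum>j = n - k + 1..n. order_stat s n j ^ 4)"
    by simp
  moreover have "sqrt (order_stat s n n ^ 4) = (order_stat s n n)\<^sup>2"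
    by (rule real_sqrt_unique) simp_all
  ultimately show ?thesis unfolding rho_sq_def by (intro max.coboundedI2) simp
qed

lemma nat_ceiling_sqrt_bounds:
  fixes n :: nat
  assumes "1 \<le> n"
  defines "k \<equiv> nat \<lceil>sqrt (real n)\<rceil>"
  shows "1 \<le> k" "sqrt (real n) \<le> real k" "real k < sqrt (real n) + 1"
proof -
  have "0 < sqrt (real n)" using assms(1) by simp
  then have "0 < \<lceil>sqrt (real n)\<rceil>" by simp
  then have k: "real k = of_int \<lceil>sqrt (real n)\<rceil>" and "0 < k" unfolding k_def by simp_all
  then show "1 \<le> k" by simp
  show "sqrt (real n) \<le> real k" "real k < sqrt (real n) + 1" unfolding k by linarith+
qed

text \<open>
  A window of length \<open>\<lceil>sqrt n\<rceil>\<close> in the upper half of the sorted noise levels.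
\<close>

lemma rho_sqrt_sq_ge_polynomial:
  assumes "1 \<le> n" "0 \<le> v" "0 \<le> t" and s: "\<And>i. i \<in> {1..n} \<Longrightarrow> v * real i powr t \<le> s i"
  shows "ln (9 / 8) * (sqrt (real n) * (v * (real n / 2) powr t)\<^sup>2) \<le> rho_sqrt_sq s n"
proof -
  define k where "k = nat \<lceil>sqrt (real n)\<rceil>"
  \<comment> \<open>A window that starts at the median: its terms have the order of the largest ones, and
      \<open>n - l\<close> is still of order \<open>k\<^sup>2\<close>, which keeps the logarithm away
      from \<open>0\<close>.\<close>
  define l where "l = (n - 1) div 2"
  note k = nat_ceiling_sqrt_bounds[OF \<open>1 \<le> n\<close>, folded k_def]
  have l: "real n / 2 \<le> real (l + 1)" "(real n + 1) / 2 \<le> real (n - l)" "l \<le> n"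
  proof -
    have "n \<le> 2 * (l + 1)" "n + 1 \<le> 2 * (n - l)" and "l \<le> n"
      unfolding l_def using \<open>1 \<le> n\<close> by presburger+
    then have "real n \<le> real (2 * (l + 1))" "real (n + 1) \<le> real (2 * (n - l))"
      by (simp_all only: of_nat_le_iff)
    then have "real n \<le> 2 * real (l + 1)" "real n + 1 \<le> 2 * real (n - l)"
      by (simp_all only: of_nat_mult of_nat_add of_nat_numeral of_nat_1)
    then show "real n / 2 \<le> real (l + 1)" "(real n + 1) / 2 \<le> real (n - l)" by simp_all
    show "l \<le> n" by fact
  qed
  have "0 \<le> (sqrt (real n) - 1)\<^sup>2" by simp
  then have amgm: "sqrt (real n) \<le> (real n + 1) / 2" using \<open>1 \<le> n\<close> by (simp add: power2_diff)
  then have "real k < real (n - l) + 1" using k(3) l(2) by linarith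
  then have lk: "l + k \<le> n" using l(3) by linarith
  then have ln_k: "l \<le> n - k" by linarith
  have "1 \<le> sqrt (real n)" using \<open>1 \<le> n\<close> by simp
  then have "real k \<le> 2 * sqrt (real n)" using k(3) by linarith
  then have "(real k)\<^sup>2 \<le> (2 * sqrt (real n))\<^sup>2" by (intro power_mono) auto
  then have "(real k)\<^sup>2 \<le> 8 * real (n - l)" using l(2) by (simp add: power_mult_distrib)
  then have "1 / 8 \<le> real (n - l) / (real k)\<^sup>2" using k(1) by (simp add: field_simps)
  then have "1 + 1 / 8 \<le> 1 + max (real (n - l) / (real k)\<^sup>2) (sqrt (real (n - l) / (real k)\<^sup>2))"
    by (intro add_left_mono max.coboundedI1)
  then have log: "ln (9 / 8) \<le> ln (1 + max (real (n - l) / (real k)\<^sup>2) (sqrt (real (n - l) / (real k)\<^sup>2)))"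
    by (subst ln_le_cancel_iff) auto
  have mono: "mono_on {1..n} (\<lambda>i. v * real i powr t)"
    using assms(2,3) by (intro mono_onI mult_left_mono powr_mono2) auto
  have low: "(v * (real n / 2) powr t)\<^sup>2 \<le> (order_stat s n j)\<^sup>2" if "j \<in> {l + 1..l + k}" for j
  proof (rule power_mono)
    have jn: "j \<in> {1..n}" using that lk unfolding atLeastAtMost_iff by linarith
    have "v * (real n / 2) powr t \<le> v * real j powr t"
      using that l(1) assms(2,3) by (intro mult_left_mono powr_mono2) auto
    also have "\<dots> \<le> order_stat s n j" by (rule order_stat_ge[OF jn s mono])
    finally show "v * (real n / 2) powr t \<le> order_stat s n j" .
  qed (use assms in simp)
  have "sqrt (real n) * (v * (real n / 2) powr t)\<^sup>2 \<le> real k * (v * (real n / 2) powr t)\<^sup>2"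
    using k(2) by (intro mult_right_mono) auto
  also have "\<dots> = (\<Sum>j = l + 1..l + k. (v * (real n / 2) powr t)\<^sup>2)" by simp
  also have "\<dots> \<le> Sigma_sq s n l k" unfolding Sigma_sq_def by (intro sum_mono low)
  finally have Sig: "sqrt (real n) * (v * (real n / 2) powr t)\<^sup>2 \<le> Sigma_sq s n l k" .
  have "ln (9 / 8) * (sqrt (real n) * (v * (real n / 2) powr t)\<^sup>2)
      \<le> ln (1 + max (real (n - l) / (real k)\<^sup>2) (sqrt (real (n - l) / (real k)\<^sup>2))) * Sigma_sq s n l k"
    using log Sig by (intro mult_mono) (auto intro: order.trans[OF _ log])
  also have "\<dots> \<le> rho_sqrt_sq s n"
    unfolding rho_sqrt_sq_def k_def[symmetric]
    using rho_sq_ge_window[OF ln_k] by (simp add: mult.commute)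
  finally show ?thesis .
qed

text \<open>
  The sum of fourth powers is bounded from below by its largest term.  No more is needed if \<open>w\<close> grows
  exponentially, since sums are then of the order of their largest term.
\<close>

lemma rho_sqrt_sq_ge_last:
  assumes "1 \<le> n" "0 \<le> w n" "mono_on {1..n} w" "\<And>i. i \<in> {1..n} \<Longrightarrow> w i \<le> s i"
  shows "(w n)\<^sup>2 \<le> rho_sqrt_sq s n"
proof -
  have "w n \<le> order_stat s n n" using assms by (intro order_stat_ge) auto
  then have "(w n)\<^sup>2 \<le> (order_stat s n n)\<^sup>2" using assms(2) by (intro power_mono)
  also have "\<dots> \<le> rho_sqrt_sq s n"
    unfolding rho_sqrt_sq_def using nat_ceiling_sqrt_bounds(1)[OF assms(1)] assms(1)
    by (intro rho_sq_ge_top)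
  finally show ?thesis .
qed

lemma rate_sq_ge:
  assumes "D \<in> {1..N}"
  shows "min (rho_sqrt_sq s D) (bias_sq a p R D) \<le> rate_sq N s a p R"
  unfolding rate_sq_def using assms by (intro cSUP_upper bdd_above_finite) auto

lemma D_dagger_bias_le:
  assumes "D_dagger N s a p R < N"
  shows "bias_sq a p R (D_dagger N s a p R) \<le> rho_sqrt_sq s (D_dagger N s a p R)"
proof -
  let ?S = "{D \<in> {1..N}. bias_sq a p R D \<le> rho_sqrt_sq s D}"
  have "?S \<noteq> {}" using assms by (auto simp: D_dagger_def Let_def split: if_splits)
  then have "D_dagger N s a p R = Inf ?S" by (simp only: D_dagger_def Let_def if_False)
  with Inf_nat_def1[OF \<open>?S \<noteq> {}\<close>] have "D_dagger N s a p R \<in> ?S" by (simp only:)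
  then show ?thesis by blast
qed

lemma rho_less_bias_below_D_dagger:
  assumes "D \<in> {1..N}" "D < D_dagger N s a p R"
  shows "rho_sqrt_sq s D < bias_sq a p R D"
proof (rule ccontr)
  assume "\<not> rho_sqrt_sq s D < bias_sq a p R D"
  then have mem: "D \<in> {D \<in> {1..N}. bias_sq a p R D \<le> rho_sqrt_sq s D}" using assms by auto
  then have "D_dagger N s a p R = Inf {D \<in> {1..N}. bias_sq a p R D \<le> rho_sqrt_sq s D}"
    unfolding D_dagger_def Let_def by (intro if_not_P) blast
  also have "\<dots> \<le> D" using mem by (rule wellorder_Inf_le1)
  finally show False using assms by simp
qed

lemma rate_sq_ge_bias_D_dagger:
  assumes "1 \<le> N" "D_dagger N s a p R < N"
  shows "bias_sq a p R (D_dagger N s a p R) \<le> rate_sq N s a p R"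
proof -
  have "min (rho_sqrt_sq s (D_dagger N s a p R)) (bias_sq a p R (D_dagger N s a p R)) \<le> rate_sq N s a p R"
    by (rule rate_sq_ge[OF D_dagger_mem[OF assms(1)]])
  then show ?thesis using D_dagger_bias_le[OF assms(2)] by simp
qed

lemma rate_sq_ge_rho_below_D_dagger:
  assumes "1 \<le> N" "2 \<le> D_dagger N s a p R"
  shows "rho_sqrt_sq s (D_dagger N s a p R - 1) \<le> rate_sq N s a p R"
proof -
  have mem: "D_dagger N s a p R - 1 \<in> {1..N}" using assms(2) D_dagger_mem[OF assms(1), of s a p R] unfolding atLeastAtMost_iff by linarith
  show ?thesis
    using rate_sq_ge[OF mem, of s a p R] rho_less_bias_below_D_dagger[OF mem, of s a p R] assms(2)
    by linarith
qed


section \<open>Energy of parameters in the ellipsoid\<close>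

text \<open>
  Uses \<open>(\<theta> j)\<^sup>2 = (a j powr p * \<bar>\<theta> j\<bar> powr p) * (a j powr (- p) * \<bar>\<theta> j\<bar> powr (2 - p))\<close>: the first factor is
  summable by the ellipsoid condition, the second is bounded by hypothesis.
\<close>

lemma ellipsoid_sum_sq_le:
  assumes \<theta>: "\<theta> \<in> ellipsoid N a p R" and a: "\<And>j. j \<in> {1..N} \<Longrightarrow> 0 < a j" and "p < 2" and A: "A \<subseteq> {1..N}" and B: "0 \<le> B"
    and le: "\<And>j. j \<in> A \<Longrightarrow> a j powr (- p) * \<bar>\<theta> j\<bar> powr (2 - p) \<le> B"
  shows "(\<Sum>j\<in>A. (\<theta> j)\<^sup>2) \<le> R powr p * B"
proof -
  have "(\<Sum>j\<in>A. (\<theta> j)\<^sup>2) \<le> (\<Sum>j\<in>A. a j powr p * \<bar>\<theta> j\<bar> powr p * B)"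
  proof (rule sum_mono)
    fix j assume j: "j \<in> A"
    then have aj: "0 < a j" using a A by auto
    have "(\<theta> j)\<^sup>2 = \<bar>\<theta> j\<bar> powr 2"
      by (cases "\<theta> j = 0") (auto simp: powr_numeral)
    also have "\<dots> = \<bar>\<theta> j\<bar> powr p * \<bar>\<theta> j\<bar> powr (2 - p)" by (simp flip: powr_add)
    also have "\<dots> = a j powr p * \<bar>\<theta> j\<bar> powr p * (a j powr (- p) * \<bar>\<theta> j\<bar> powr (2 - p))"
      using aj by (simp add: powr_minus field_simps)
    also have "\<dots> \<le> a j powr p * \<bar>\<theta> j\<bar> powr p * B"
      using le[OF j] by (intro mult_left_mono) auto
    finally show "(\<theta> j)\<^sup>2 \<le> a j powr p * \<bar>\<theta> j\<bar> powr p * B" .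
  qed
  also have "\<dots> = (\<Sum>j\<in>A. a j powr p * \<bar>\<theta> j\<bar> powr p) * B" by (simp add: sum_distrib_right)
  also have "\<dots> \<le> (\<Sum>j=1..N. a j powr p * \<bar>\<theta> j\<bar> powr p) * B"
    using A B by (intro mult_right_mono sum_mono2) auto
  also have "\<dots> \<le> R powr p * B"
    using \<theta> B by (intro mult_right_mono) (auto simp: ellipsoid_def)
  finally show ?thesis .
qed

lemma ellipsoid_coord_le:
  assumes \<theta>: "\<theta> \<in> ellipsoid N a p R" and a: "0 < a j" and "0 < p" "0 < R" and j: "j \<in> {1..N}"
  shows "a j * \<bar>\<theta> j\<bar> \<le> R"
proof -
  have "a j powr p * \<bar>\<theta> j\<bar> powr p \<le> (\<Sum>j=1..N. a j powr p * \<bar>\<theta> j\<bar> powr p)"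
    using j by (intro member_le_sum) auto
  also have "\<dots> \<le> R powr p" using \<theta> by (simp add: ellipsoid_def)
  finally have "(a j * \<bar>\<theta> j\<bar>) powr p \<le> R powr p" using a by (simp add: powr_mult)
  then show ?thesis using powr_less_mono2[of p R "a j * \<bar>\<theta> j\<bar>"] assms by (meson less_imp_le not_le)
qed

text \<open>
  The inclusion of \<open>l\<^sub>p\<close> in \<open>l\<^sub>2\<close> for \<open>p < 2\<close>, with the weights replaced by the smallest one.
\<close>

lemma ellipsoid_norm_sq_le:
  assumes \<theta>: "\<theta> \<in> ellipsoid N a p R" and a: "\<And>j. j \<in> {1..N} \<Longrightarrow> 0 < a j" and mono: "mono_on {1..N} a"
    and "0 < p" "p < 2" "0 < R" "1 \<le> N"
  shows "(\<Sum>j=1..N. (\<theta> j)\<^sup>2) \<le> (R / a 1)\<^sup>2"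
proof -
  have a1: "0 < a 1" using a \<open>1 \<le> N\<close> by simp
  have "(\<Sum>j=1..N. (\<theta> j)\<^sup>2) \<le> R powr p * (a 1 powr (- p) * (R / a 1) powr (2 - p))"
  proof (rule ellipsoid_sum_sq_le[OF \<theta> a \<open>p < 2\<close> order.refl])
    fix j assume j: "j \<in> {1..N}"
    have aj: "a 1 \<le> a j" using mono_onD[OF mono, of 1 j] j by auto
    have "a 1 * \<bar>\<theta> j\<bar> \<le> a j * \<bar>\<theta> j\<bar>" using aj by (intro mult_right_mono) auto
    also have "\<dots> \<le> R" using ellipsoid_coord_le[OF \<theta> a[OF j]] assms j by auto
    finally have "\<bar>\<theta> j\<bar> \<le> R / a 1" using a1 by (simp add: field_simps)
    then have "\<bar>\<theta> j\<bar> powr (2 - p) \<le> (R / a 1) powr (2 - p)"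
      using assms by (intro powr_mono2) auto
    moreover have "a j powr (- p) \<le> a 1 powr (- p)"
      using aj a1 assms by (intro powr_mono2') auto
    ultimately show "a j powr (- p) * \<bar>\<theta> j\<bar> powr (2 - p) \<le> a 1 powr (- p) * (R / a 1) powr (2 - p)"
      by (intro mult_mono) auto
  qed auto
  also have "\<dots> = (R / a 1) powr p * (R / a 1) powr (2 - p)"
    using assms a1 by (simp add: powr_minus powr_divide field_simps)
  also have "\<dots> = (R / a 1) powr 2" by (simp flip: powr_add)
  also have "\<dots> = (R / a 1)\<^sup>2" using a1 \<open>0 < R\<close> by (intro powr_numeral) simp
  finally show ?thesis .
qed

text \<open>
  The monotone weight \<open>a j powr (- p) * s j powr (2 - p)\<close> is largest at \<open>j = D\<close>.  There it is expressed by
  the bias term, which is the quantity that the rate controls.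
\<close>

lemma tail_energy_le:
  fixes N \<sigma> b a p R
  defines "s \<equiv> noise_level \<sigma> b"
  assumes "0 < p" "p < 2" "0 < R" "0 < \<sigma>"
    and a: "\<And>j. j \<in> {1..N} \<Longrightarrow> 0 < a j" and b: "\<And>j. j \<in> {1..N} \<Longrightarrow> 0 < b j"
    and anti: "antimono_on {1..N} (\<lambda>j. a j powr (- p) * b j powr (- (2 - p)))"
    and \<theta>: "\<theta> \<in> ellipsoid N a p R" and D: "D \<in> {1..N}" and T: "0 \<le> T"
    and small: "\<And>j. j \<in> {D + 1..N} \<Longrightarrow> \<bar>\<theta> j\<bar> \<le> s j * T"
  shows "(\<Sum>j = D + 1..N. (\<theta> j)\<^sup>2)
    \<le> T powr (2 - p) * (bias_sq a p R D powr (p / 2) * (sqrt (real D) * (s D)\<^sup>2) powr (1 - p / 2))"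
proof -
  have s: "0 < s j" "s j powr (2 - p) = \<sigma> powr (2 - p) * b j powr (- (2 - p))" if "j \<in> {1..N}" for j
  proof -
    show "0 < s j" using b[OF that] \<open>0 < \<sigma>\<close> by (simp add: s_def noise_level_def)
    have "b j powr (- (2 - p)) = inverse (b j) powr (2 - p)" by (simp only: powr_minus inverse_powr)
    then show "s j powr (2 - p) = \<sigma> powr (2 - p) * b j powr (- (2 - p))"
      by (simp only: s_def noise_level_def powr_mult)
  qed
  define B where "B = a D powr (- p) * s D powr (2 - p)"
  have "(\<Sum>j = D + 1..N. (\<theta> j)\<^sup>2) \<le> R powr p * (T powr (2 - p) * B)"
  proof (rule ellipsoid_sum_sq_le[OF \<theta> a \<open>p < 2\<close>])
    show "{D + 1..N} \<subseteq> {1..N}" "0 \<le> T powr (2 - p) * B" by (auto simp: B_def)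
    fix j assume j: "j \<in> {D + 1..N}"
    then have jN: "j \<in> {1..N}" by auto
    have "\<bar>\<theta> j\<bar> powr (2 - p) \<le> (s j * T) powr (2 - p)"
      using small[OF j] assms by (intro powr_mono2) auto
    then have "a j powr (- p) * \<bar>\<theta> j\<bar> powr (2 - p) \<le> a j powr (- p) * (s j * T) powr (2 - p)"
      by (intro mult_left_mono) auto
    also have "\<dots> = T powr (2 - p) * (\<sigma> powr (2 - p) * (a j powr (- p) * b j powr (- (2 - p))))"
      by (simp only: powr_mult s(2)[OF jN] mult_ac)
    also have "\<dots> \<le> T powr (2 - p) * (\<sigma> powr (2 - p) * (a D powr (- p) * b D powr (- (2 - p))))"
      using monotone_onD[OF anti, of D j] j D by (intro mult_left_mono) auto
    also have "\<dots> = T powr (2 - p) * B" by (simp only: s(2)[OF D] B_def mult_ac)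
    finally show "a j powr (- p) * \<bar>\<theta> j\<bar> powr (2 - p) \<le> T powr (2 - p) * B" .
  qed
  also have "R powr p * (T powr (2 - p) * B)
    = T powr (2 - p) * ((R\<^sup>2 / (a D)\<^sup>2) powr (p / 2) * ((s D)\<^sup>2) powr (1 - p / 2))"
  proof -
    have sq: "(x\<^sup>2) powr q = x powr (2 * q)" if "0 < x" for x q :: real
    proof -
      have "(x\<^sup>2) powr q = (x powr 2) powr q" by (simp only: powr_numeral[OF less_imp_le[OF that]])
      then show ?thesis by (simp only: powr_powr)
    qed
    have "(R\<^sup>2 / (a D)\<^sup>2) powr (p / 2) = R powr p * a D powr (- p)"
    proof -
      have "2 * (p / 2) = p" by simp
      then show ?thesis
        by (simp only: powr_divide sq[OF \<open>0 < R\<close>] sq[OF a[OF D]] powr_minus_divide times_divide_eq_right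
            mult_1_right)
    qed
    moreover have "((s D)\<^sup>2) powr (1 - p / 2) = s D powr (2 - p)"
    proof -
      have "2 * (1 - p / 2) = 2 - p" by simp
      then show ?thesis by (simp only: sq[OF s(1)[OF D]])
    qed
    ultimately show ?thesis by (simp only: B_def mult_ac)
  qed
  also have "(R\<^sup>2 / (a D)\<^sup>2) powr (p / 2) * ((s D)\<^sup>2) powr (1 - p / 2)
    = bias_sq a p R D powr (p / 2) * (sqrt (real D) * (s D)\<^sup>2) powr (1 - p / 2)"
  proof -
    \<comment> \<open>The power of \<open>sqrt D\<close> in the bias term cancels the one that
        accompanies \<open>(s D)\<^sup>2\<close>.\<close>
    have "(1 - 2 / p) * (p / 2) + (1 - p / 2) = 0" using \<open>0 < p\<close> by (simp add: field_simps)
    moreover have "sqrt (real D) \<noteq> 0" using D by simp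
    ultimately have one: "sqrt (real D) powr ((1 - 2 / p) * (p / 2)) * sqrt (real D) powr (1 - p / 2) = 1"
      by (simp only: powr_add[symmetric] powr_zero_eq_one if_False)
    have "bias_sq a p R D powr (p / 2) * (sqrt (real D) * (s D)\<^sup>2) powr (1 - p / 2)
      = (R\<^sup>2 / (a D)\<^sup>2) powr (p / 2) * ((s D)\<^sup>2) powr (1 - p / 2)
        * (sqrt (real D) powr ((1 - 2 / p) * (p / 2)) * sqrt (real D) powr (1 - p / 2))"
      by (simp only: bias_sq_def powr_mult powr_powr mult_ac)
    then show ?thesis by (simp only: one mult_1_right)
  qed
  finally show ?thesis .
qed


section \<open>Power of the test when the rate controls the noise\<close>

text \<open>
  The hypotheses that the mildly and the severely ill-posed case have in common.
\<close>

definition admissible ::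
  "real \<Rightarrow> nat \<Rightarrow> real \<Rightarrow> real \<Rightarrow> (nat \<Rightarrow> real) \<Rightarrow> (nat \<Rightarrow> real) \<Rightarrow> bool" where
  "admissible p N R \<sigma> a b \<longleftrightarrow>
     2 \<le> N \<and> 0 < R \<and> 0 < \<sigma> \<and>
     (\<forall>j\<in>{1..N}. 0 < a j) \<and> mono_on {1..N} a \<and>
     (\<forall>j\<in>{1..N}. 0 < b j) \<and>
     antimono_on {1..N} (\<lambda>j. a j powr (- p) * b j powr (- (2 - p)))"

text \<open>
  Compares the noise up to \<open>D\<close> with the rate at \<open>D - 1\<close>, where \<open>\<rho>\<close> is still below the bias if
  \<open>D = D\<^sup>\<dagger>\<close>.  The first inequality serves the test on the sum of squares, the second one the coordinate
  tests; \<open>h\<close> is the loss in the latter: \<open>1\<close> for polynomial, \<open>sqrt D\<close> for exponential growth.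
\<close>

definition rho_controls_noise :: "real \<Rightarrow> real \<Rightarrow> (nat \<Rightarrow> real) \<Rightarrow> nat \<Rightarrow> bool" where
  "rho_controls_noise M h s D \<longleftrightarrow>
     sqrt (\<Sum>j = 1..D. s j ^ 4) \<le> M * rho_sqrt_sq s (D - 1) \<and>
     sqrt (real D) * (s D)\<^sup>2 \<le> M * h * rho_sqrt_sq s (D - 1)"

text \<open>
  A parameter that both tests miss has less energy than the separation radius: the first \<open>D\<^sup>\<dagger>\<close>
  coordinates contribute a multiple of \<open>\<rho>\<close>, the others the geometric mean of \<open>bias D\<^sup>\<dagger>\<close> and
  \<open>h * \<rho>\<close>, both of which are bounded by the rate, apart from \<open>h powr (1 - p / 2)\<close> and the logarithm.
\<close>

lemma sup_type_II_error_le: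
  assumes "0 < \<alpha>" "\<alpha> < 1" "0 < \<beta>" "\<beta> < 1" "0 < p" "p < 2" "1 \<le> M"
  obtains C where "C > 0"
    "\<And>N R \<sigma> a b h. admissible p N R \<sigma> a b \<Longrightarrow> 1 \<le> h \<Longrightarrow>
      (2 \<le> D_dagger N (noise_level \<sigma> b) a p R \<Longrightarrow>
        rho_controls_noise M h (noise_level \<sigma> b) (D_dagger N (noise_level \<sigma> b) a p R)) \<Longrightarrow>
      sup_type_II_error N \<sigma> b a p R \<alpha>
        (C * ln (real N) * h powr (1 - p / 2) * rate_sq N (noise_level \<sigma> b) a p R) \<le> ennreal \<beta>"
proof -
  obtain W :: real where "W \<ge> 2" and W: "\<And>N i :: nat. 2 \<le> N \<Longrightarrow> i \<in> {1..N} \<Longrightarrow>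
       tail_width (3 * \<alpha> / (pi\<^sup>2 * (real i)\<^sup>2)) + tail_width \<beta> \<le> W * sqrt (ln (real N))"
    using tail_width_level_bound[OF assms(1-4)] by metis
  define K where "K = 2 * sqrt (4 / \<alpha>) + 24 / \<beta>"
  have K: "K > 0" unfolding K_def using assms by (intro add_nonneg_pos) auto
  \<comment> \<open>\<open>K M\<close> pays for the first block and \<open>W\<^sup>2 M\<close> for the
      remaining coordinates. The factor \<open>2\<close> compensates \<open>ln N \<ge> ln 2 \<ge> 2 /
      3\<close>, and the summand \<open>1\<close> makes \<open>C ln N > 1\<close>, for the case
      \<open>D\<^sup>\<dagger> = 1\<close>.\<close>
  define C where "C = 2 * (K * M + 1) + W\<^sup>2 * M"
  show thesis
  proof
    have "0 < K * M" using K assms by simp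
    moreover have "0 \<le> W\<^sup>2 * M" using assms by simp
    ultimately have "2 \<le> C" unfolding C_def by (simp add: add_increasing2)
    then show "C > 0" by simp
    fix R \<sigma> h :: real and a b :: "nat \<Rightarrow> real" and N :: nat
    assume adm: "admissible p N R \<sigma> a b" and h: "1 \<le> h"
      and noise: "2 \<le> D_dagger N (noise_level \<sigma> b) a p R \<Longrightarrow>
        rho_controls_noise M h (noise_level \<sigma> b) (D_dagger N (noise_level \<sigma> b) a p R)"
    have N: "2 \<le> N" and R: "0 < R" and \<sigma>: "0 < \<sigma>" and a: "\<And>j. j \<in> {1..N} \<Longrightarrow> 0 < a j"
      and mono: "mono_on {1..N} a" and b: "\<And>j. j \<in> {1..N} \<Longrightarrow> 0 < b j"
      and anti: "antimono_on {1..N} (\<lambda>j. a j powr (- p) * b j powr (- (2 - p)))"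
      using adm by (auto simp: admissible_def)
    define s where "s = noise_level \<sigma> b"
    define D where "D = D_dagger N s a p R"
    define L where "L = ln (real N)"
    define H where "H = h powr (1 - p / 2)"
    define r where "r = rate_sq N s a p R"
    have D: "D \<in> {1..N}" unfolding D_def using N by (intro D_dagger_mem) simp
    have "ln 2 \<le> ln (real N)" using N by simp
    then have L: "2 / 3 \<le> L" unfolding L_def using ln2_ge_two_thirds by simp
    have H: "1 \<le> H" unfolding H_def using h assms by (intro ge_one_powr_ge_zero) auto
    have LH: "L \<le> L * H" using L H mult_left_mono[of 1 H L] by simp
    have bias_pos: "0 < bias_sq a p R D" using D a[OF D] R by (auto simp: bias_sq_def)
    have bias_D: "bias_sq a p R D \<le> r" if "D < N"
      using rate_sq_ge_bias_D_dagger[of N s a p R] that N by (simp add: D_def r_def)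
    have "type_II_error N \<sigma> b a p R \<alpha> \<theta> \<le> ennreal \<beta>"
      if \<theta>: "\<theta> \<in> ellipsoid N a p R" and large: "C * L * H * r \<le> (\<Sum>j = 1..N. (\<theta> j)\<^sup>2)" for \<theta>
    proof (rule ccontr)
      assume missed: "\<not> type_II_error N \<sigma> b a p R \<alpha> \<theta> \<le> ennreal \<beta>"
      show False
      proof (cases "D = 1")
        case True
        \<comment> \<open>The whole ellipsoid lies below the separation radius.\<close>
        have "(\<Sum>j = 1..N. (\<theta> j)\<^sup>2) \<le> bias_sq a p R D"
          using ellipsoid_norm_sq_le[OF \<theta> a mono] assms R N by (simp add: True bias_sq_def power_divide)
        also have "\<dots> \<le> r" using bias_D True N by simp
        finally have le: "(\<Sum>j = 1..N. (\<theta> j)\<^sup>2) \<le> r" .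
        have r: "0 < r" using bias_D bias_pos True N by simp
        have "2 / 3 \<le> L * H" using L LH by linarith
        with \<open>2 \<le> C\<close> have "2 * (2 / 3) \<le> C * (L * H)" by (intro mult_mono) auto
        then have "1 < C * L * H" by (simp add: mult.assoc)
        then have "r < C * L * H * r" using r by simp
        then show False using le large by linarith
      next
        case False
        then have D2: "2 \<le> D" using D by auto
        define \<rho> where "\<rho> = rho_sqrt_sq s (D - 1)"
        have S: "sqrt (\<Sum>j = 1..D. s j ^ 4) \<le> M * \<rho>" and sD: "sqrt (real D) * (s D)\<^sup>2 \<le> M * h * \<rho>"
          using noise D2 by (auto simp: rho_controls_noise_def s_def D_def \<rho>_def)
        have \<rho>r: "\<rho> \<le> r"
          using rate_sq_ge_rho_below_D_dagger[of N s a p R] D2 N by (simp add: D_def r_def \<rho>_def)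
        have "0 \<le> M * \<rho>" using S by (rule order.trans[rotated]) (simp add: sum_nonneg)
        then have \<rho>0: "0 \<le> \<rho>" using assms by (simp add: zero_le_mult_iff)
        have r0: "0 \<le> r" using \<rho>0 \<rho>r by simp
        have head: "(\<Sum>j = 1..D. (\<theta> j)\<^sup>2) < K * M * r"
        proof -
          have "(\<Sum>j = 1..D. (\<theta> j)\<^sup>2) < K * sqrt (\<Sum>j = 1..D. s j ^ 4)"
          proof (rule ccontr)
            assume "\<not> ?thesis"
            then have "type_II_error N \<sigma> b a p R \<alpha> \<theta> \<le> ennreal \<beta>"
              using N unfolding not_less s_def D_def K_def
              by (intro type_II_error_sum[OF _ \<sigma> b assms(1-4)]) auto
            then show False using missed by simp
          qed
          also have "\<dots> \<le> K * (M * \<rho>)" using S K by simp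
          also have "\<dots> \<le> K * (M * r)" using \<rho>r K assms by simp
          finally show ?thesis by (simp add: mult.assoc)
        qed
        define T where "T = W * sqrt L"
        \<comment> \<open>This permits to replace \<open>T powr (2 - p)\<close> by
            \<open>T\<^sup>2\<close>, which is proportional to \<open>ln N\<close>.\<close>
        have T1: "1 \<le> T\<^sup>2"
        proof -
          have "2\<^sup>2 * (2 / 3) \<le> W\<^sup>2 * L" using \<open>W \<ge> 2\<close> L by (intro mult_mono power_mono) auto
          then show ?thesis using L by (simp add: T_def power_mult_distrib)
        qed
        have T0: "0 < T" unfolding T_def using \<open>W \<ge> 2\<close> L by simp
        have small: "\<bar>\<theta> j\<bar> \<le> s j * T" if j: "j \<in> {D + 1..N}" for j
        proof -
          have sj: "0 < s j" using b[of j] j \<sigma> by (simp add: s_def noise_level_def)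
          have "\<bar>\<theta> j\<bar> < s j * (tail_width (3 * \<alpha> / (pi\<^sup>2 * (real (j - D))\<^sup>2)) + tail_width \<beta>)"
          proof (rule ccontr)
            assume "\<not> ?thesis"
            then have "type_II_error N \<sigma> b a p R \<alpha> \<theta> \<le> ennreal \<beta>"
              using j unfolding not_less s_def D_def
              by (intro type_II_error_coord[OF \<sigma> b assms(1-4)])
            then show False using missed by simp
          qed
          also have "\<dots> \<le> s j * T"
            unfolding T_def L_def using sj j D N by (intro mult_left_mono W) auto
          finally show ?thesis by simp
        qed
        have tail: "(\<Sum>j = D + 1..N. (\<theta> j)\<^sup>2) \<le> W\<^sup>2 * L * (M * H * r)"
        proof (cases "D = N")
          case True
          then show ?thesis using r0 assms L H by simp
        next
          case False
          then have bias_r: "bias_sq a p R D \<le> r" using bias_D D by simp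
          have "(\<Sum>j = D + 1..N. (\<theta> j)\<^sup>2)
            \<le> T powr (2 - p) * (bias_sq a p R D powr (p / 2) * (sqrt (real D) * (s D)\<^sup>2) powr (1 - p / 2))"
            unfolding s_def
            by (rule tail_energy_le[OF assms(5,6) R \<sigma> a b anti \<theta> D])
               (use small T0 in \<open>auto simp: s_def\<close>)
          also have "\<dots> \<le> T\<^sup>2 * (r powr (p / 2) * (M * H * r powr (1 - p / 2)))"
          proof (intro mult_mono)
            have "T powr (2 - p) = (T\<^sup>2) powr (1 - p / 2)"
              using T0 powr_powr[of T 2 "1 - p / 2"] by (simp add: powr_numeral)
            also have "\<dots> \<le> (T\<^sup>2) powr 1" using T1 assms by (intro powr_mono) auto
            finally show "T powr (2 - p) \<le> T\<^sup>2" using T0 by simp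
            show "bias_sq a p R D powr (p / 2) \<le> r powr (p / 2)"
              using bias_r bias_pos assms by (intro powr_mono2) auto
            have "M * h * \<rho> \<le> M * h * r" using \<rho>r h assms by (intro mult_left_mono) auto
            with sD have "sqrt (real D) * (s D)\<^sup>2 \<le> M * h * r" by linarith
            then have "(sqrt (real D) * (s D)\<^sup>2) powr (1 - p / 2) \<le> (M * h * r) powr (1 - p / 2)"
              using assms(6) by (intro powr_mono2) auto
            also have "\<dots> = M powr (1 - p / 2) * H * r powr (1 - p / 2)"
              by (simp only: powr_mult H_def)
            also have "\<dots> \<le> M powr 1 * H * r powr (1 - p / 2)"
              using assms H by (intro mult_right_mono powr_mono) auto
            finally show "(sqrt (real D) * (s D)\<^sup>2) powr (1 - p / 2) \<le> M * H * r powr (1 - p / 2)"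
              using assms by simp
            show "0 \<le> T\<^sup>2" "0 \<le> r powr (p / 2)" by simp_all
            show "0 \<le> bias_sq a p R D powr (p / 2) * (sqrt (real D) * (s D)\<^sup>2) powr (1 - p / 2)" by simp
            show "0 \<le> (sqrt (real D) * (s D)\<^sup>2) powr (1 - p / 2)" by simp
          qed
          also have "\<dots> = T\<^sup>2 * (M * H * (r powr (p / 2) * r powr (1 - p / 2)))" by (simp add: mult_ac)
          also have "r powr (p / 2) * r powr (1 - p / 2) = r"
            using r0 by (simp flip: powr_add)
          also have "T\<^sup>2 = W\<^sup>2 * L" using L by (simp add: T_def power_mult_distrib)
          finally show ?thesis .
        qed
        have "(\<Sum>j = 1..N. (\<theta> j)\<^sup>2) = (\<Sum>j = 1..D. (\<theta> j)\<^sup>2) + (\<Sum>j = D + 1..N. (\<theta> j)\<^sup>2)"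
        proof -
          have "(\<Sum>j = 1..D + (N - D). (\<theta> j)\<^sup>2)
              = (\<Sum>j = 1..D. (\<theta> j)\<^sup>2) + (\<Sum>j = D + 1..D + (N - D). (\<theta> j)\<^sup>2)"
            by (rule sum.ub_add_nat) simp
          moreover have "D + (N - D) = N" using D by simp
          ultimately show ?thesis by (simp only:)
        qed
        also have "\<dots> < K * M * r + W\<^sup>2 * L * (M * H * r)" using head tail by linarith
        also have "\<dots> \<le> C * L * H * r"
        proof -
          have "1 \<le> 2 * (L * H)" using L LH by linarith
          then have "K * M * r * 1 \<le> K * M * r * (2 * (L * H))"
            using \<open>0 < K * M\<close> r0 by (intro mult_left_mono) auto
          moreover have "0 \<le> 2 * (L * H) * r" using L H r0 by simp
          moreover have "C * L * H * r
            = K * M * r * (2 * (L * H)) + 2 * (L * H) * r + W\<^sup>2 * L * (M * H * r)"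
            by (simp add: C_def algebra_simps)
          ultimately show ?thesis by linarith
        qed
        finally show False using large by linarith
      qed
    qed
    note error_le = this
    show "sup_type_II_error N \<sigma> b a p R \<alpha>
        (C * ln (real N) * h powr (1 - p / 2) * rate_sq N (noise_level \<sigma> b) a p R) \<le> ennreal \<beta>"
      unfolding sup_type_II_error_def type_II_error_def[symmetric]
      unfolding L_def[symmetric] H_def[symmetric] s_def[symmetric] r_def[symmetric]
      by (intro SUP_least error_le) auto
  qed
qed


section \<open>Polynomially and exponentially growing noise\<close>

text \<open>
  The scale \<open>\<tau>\<close> stands for \<open>\<sigma>\<close>; all terms are quadratic in it, so \<open>M\<close> does not depend on it.
\<close>

lemma polynomial_noise_bounds:
  assumes "0 < c1" "0 < c2" "0 < t"
  obtains M where "1 \<le> M"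
    "\<And>D \<tau> s. 2 \<le> D \<Longrightarrow> 0 < \<tau> \<Longrightarrow>
      (\<And>j. j \<in> {1..D} \<Longrightarrow> \<tau> * (c1 * real j powr t) \<le> s j \<and> s j \<le> \<tau> * (c2 * real j powr t)) \<Longrightarrow>
      rho_controls_noise M 1 s D"
proof
  define c where "c = ln (9 / 8) * (1 / 2) * (c1 * (1 / 4) powr t)\<^sup>2"
  have c: "0 < c" using assms by (simp add: c_def)
  define M where "M = max 1 (c2\<^sup>2 / c)"
  show "1 \<le> M" by (simp add: M_def)
  fix D :: nat and \<tau> :: real and s :: "nat \<Rightarrow> real"
  assume D: "2 \<le> D" and \<tau>: "0 < \<tau>" and
    bounds: "\<And>j. j \<in> {1..D} \<Longrightarrow> \<tau> * (c1 * real j powr t) \<le> s j \<and> s j \<le> \<tau> * (c2 * real j powr t)"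
  \<comment> \<open>Every quantity in the claim has order \<open>X\<close>: with \<open>n = D - 1\<close>
      in place of \<open>D\<close>, or \<open>n / 2\<close>, only constants are lost.\<close>
  define X where "X = sqrt (real D) * (\<tau> * real D powr t)\<^sup>2"
  have X: "0 \<le> X" by (simp add: X_def)
  have s0: "0 \<le> s j" if "j \<in> {1..D}" for j
    using bounds[OF that] assms \<tau> by (meson less_imp_le mult_nonneg_nonneg order.trans powr_ge_zero)
  have up: "s j \<le> c2 * (\<tau> * real D powr t)" if j: "j \<in> {1..D}" for j
  proof -
    have "\<tau> * (c2 * real j powr t) \<le> \<tau> * (c2 * real D powr t)"
      using assms \<tau> j by (intro mult_left_mono powr_mono2) auto
    then show ?thesis using bounds[OF j] by (simp add: mult_ac)
  qed
  have "(\<Sum>j = 1..D. s j ^ 4) \<le> (\<Sum>j = 1..D. (c2 * (\<tau> * real D powr t)) ^ 4)"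
    by (intro sum_mono power_mono up s0)
  also have "\<dots> = (c2\<^sup>2 * X)\<^sup>2"
    by (simp add: X_def power_mult_distrib)
  finally have S: "sqrt (\<Sum>j = 1..D. s j ^ 4) \<le> c2\<^sup>2 * X"
    using X by (intro real_le_lsqrt) auto
  have "(s D)\<^sup>2 \<le> (c2 * (\<tau> * real D powr t))\<^sup>2"
    using up[of D] s0[of D] D by (intro power_mono) auto
  then have sD: "sqrt (real D) * (s D)\<^sup>2 \<le> c2\<^sup>2 * X"
    unfolding X_def by (simp only: power_mult_distrib mult.left_commute[of "c2\<^sup>2"]) (simp add: mult_left_mono)
  define n where "n = D - 1"
  have n: "1 \<le> n" "real D / 4 \<le> real n / 2" "real D / 4 \<le> real n" using D by (auto simp: n_def)
  have rho: "ln (9 / 8) * (sqrt (real n) * (\<tau> * c1 * (real n / 2) powr t)\<^sup>2) \<le> rho_sqrt_sq s n"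
    using bounds D assms \<tau> by (intro rho_sqrt_sq_ge_polynomial n(1)) (auto simp: n_def mult_ac)
  have "sqrt (real D) * (1 / 2) \<le> sqrt (real n)"
    using n(3) by (intro real_le_rsqrt) (simp add: power_mult_distrib power2_eq_square)
  moreover have "(\<tau> * c1 * ((1 / 4) powr t * real D powr t))\<^sup>2 \<le> (\<tau> * c1 * (real n / 2) powr t)\<^sup>2"
  proof -
    have "(1 / 4) powr t * real D powr t = (real D / 4) powr t"
      by (simp flip: powr_mult)
    also have "\<dots> \<le> (real n / 2) powr t" using n(2) assms by (intro powr_mono2) auto
    finally show ?thesis using assms \<tau> by (intro power_mono mult_left_mono) auto
  qed
  ultimately have "(sqrt (real D) * (1 / 2)) * (\<tau> * c1 * ((1 / 4) powr t * real D powr t))\<^sup>2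
      \<le> sqrt (real n) * (\<tau> * c1 * (real n / 2) powr t)\<^sup>2"
    by (intro mult_mono) auto
  then have "ln (9 / 8) * ((sqrt (real D) * (1 / 2)) * (\<tau> * c1 * ((1 / 4) powr t * real D powr t))\<^sup>2)
      \<le> ln (9 / 8) * (sqrt (real n) * (\<tau> * c1 * (real n / 2) powr t)\<^sup>2)"
    by (rule mult_left_mono) simp
  also note rho
  also have "ln (9 / 8) * ((sqrt (real D) * (1 / 2)) * (\<tau> * c1 * ((1 / 4) powr t * real D powr t))\<^sup>2) = c * X"
    by (simp only: c_def X_def power_mult_distrib mult_ac)
  finally have low: "c * X \<le> rho_sqrt_sq s n" .
  have "c2\<^sup>2 * X = c2\<^sup>2 / c * (c * X)" using c by simp
  also have "\<dots> \<le> M * rho_sqrt_sq s n"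
    using low c X by (intro mult_mono) (auto simp: M_def)
  finally show "rho_controls_noise M 1 s D"
    using S sD unfolding n_def rho_controls_noise_def mult_1_right by linarith
qed

lemma sum_powers_le_last:
  fixes q :: real
  assumes "1 < q"
  shows "(\<Sum>j = 1..D. q ^ j) \<le> q / (q - 1) * q ^ D"
proof (induction D)
  case 0
  then show ?case using assms by simp
next
  case (Suc D)
  have "(\<Sum>j = 1..Suc D. q ^ j) \<le> q / (q - 1) * q ^ D + q ^ Suc D" using Suc by simp
  also have "\<dots> = q / (q - 1) * q ^ Suc D" using assms by (simp add: field_simps)
  finally show ?case .
qed

text \<open>
  The lower bound for \<open>\<rho> (D - 1)\<close> has the order of \<open>(s D)\<^sup>2\<close>, and so has the root of the sum of fourth
  powers; the factor \<open>sqrt D\<close> in the second comparison remains and becomes the loss.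
\<close>

lemma exponential_noise_bounds:
  assumes "0 < c1" "0 < c2" "0 < \<gamma>"
  obtains M where "1 \<le> M"
    "\<And>D \<tau> s. 2 \<le> D \<Longrightarrow> 0 < \<tau> \<Longrightarrow>
      (\<And>j. j \<in> {1..D} \<Longrightarrow> \<tau> * (c1 * exp (\<gamma> * real j)) \<le> s j \<and> s j \<le> \<tau> * (c2 * exp (\<gamma> * real j))) \<Longrightarrow>
      rho_controls_noise M (sqrt (real D)) s D"
proof
  define q where "q = exp (4 * \<gamma>)"
  have q: "1 < q" using assms by (simp add: q_def)
  define g where "g = sqrt (q / (q - 1))"
  have g: "1 \<le> g" unfolding g_def using q by simp
  \<comment> \<open>The factor \<open>exp (- \<gamma>)\<close> is the price of the step from
      \<open>D\<close> to \<open>D - 1\<close>.\<close>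
  define c where "c = (c1 * exp (- \<gamma>))\<^sup>2"
  have c: "0 < c" using assms by (simp add: c_def)
  define M where "M = max 1 (g * c2\<^sup>2 / c)"
  show "1 \<le> M" by (simp add: M_def)
  fix D :: nat and \<tau> :: real and s :: "nat \<Rightarrow> real"
  assume D: "2 \<le> D" and \<tau>: "0 < \<tau>" and
    bounds: "\<And>j. j \<in> {1..D} \<Longrightarrow> \<tau> * (c1 * exp (\<gamma> * real j)) \<le> s j \<and> s j \<le> \<tau> * (c2 * exp (\<gamma> * real j))"
  \<comment> \<open>The geometric sum of the fourth powers has the order of its last term, hence no
      factor \<open>D\<close> in \<open>X\<close>.\<close>
  define X where "X = (\<tau> * exp (\<gamma> * real D))\<^sup>2"
  have X: "0 \<le> X" by (simp add: X_def)
  have s0: "0 \<le> s j" if "j \<in> {1..D}" for j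
    using bounds[OF that] assms \<tau> by (meson exp_ge_zero less_imp_le mult_nonneg_nonneg order.trans)
  have q_pow: "exp (\<gamma> * real j) ^ 4 = q ^ j" for j
    by (simp add: q_def exp_of_nat_mult[symmetric] mult_ac)
  have "(\<Sum>j = 1..D. s j ^ 4) \<le> (\<Sum>j = 1..D. (\<tau> * (c2 * exp (\<gamma> * real j))) ^ 4)"
    using bounds by (intro sum_mono power_mono s0) auto
  also have "\<dots> = (\<tau> * c2) ^ 4 * (\<Sum>j = 1..D. q ^ j)"
    by (simp only: power_mult_distrib q_pow sum_distrib_left mult.assoc)
  also have "\<dots> \<le> (\<tau> * c2) ^ 4 * (q / (q - 1) * q ^ D)"
    by (intro mult_left_mono sum_powers_le_last q) simp
  also have "\<dots> = (g * c2\<^sup>2 * X)\<^sup>2"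
  proof -
    have "g\<^sup>2 = q / (q - 1)" unfolding g_def using q by simp
    moreover have "X\<^sup>2 = \<tau> ^ 4 * q ^ D" by (simp add: X_def power_mult_distrib q_pow)
    moreover have "(c2\<^sup>2)\<^sup>2 = c2 ^ 4" by simp
    ultimately show ?thesis by (simp only: power_mult_distrib mult_ac)
  qed
  finally have S: "sqrt (\<Sum>j = 1..D. s j ^ 4) \<le> g * c2\<^sup>2 * X"
    using X g by (intro real_le_lsqrt) auto
  have "(s D)\<^sup>2 \<le> (\<tau> * (c2 * exp (\<gamma> * real D)))\<^sup>2"
    using bounds[of D] s0[of D] D by (intro power_mono) auto
  also have "\<dots> = 1 * (c2\<^sup>2 * X)" by (simp only: X_def power_mult_distrib mult_ac mult_1_left)
  also have "\<dots> \<le> g * (c2\<^sup>2 * X)" using g X by (intro mult_right_mono) auto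
  finally have sD: "(s D)\<^sup>2 \<le> g * c2\<^sup>2 * X" by (simp only: mult.assoc)
  define n where "n = D - 1"
  have n: "1 \<le> n" "real n = real D - 1" using D by (auto simp: n_def)
  have "(\<tau> * (c1 * exp (\<gamma> * real n)))\<^sup>2 \<le> rho_sqrt_sq s n"
    using bounds assms \<tau> D
    by (intro rho_sqrt_sq_ge_last[of n "\<lambda>j. \<tau> * (c1 * exp (\<gamma> * real j))"] mono_onI mult_left_mono n(1))
       (auto simp: n_def)
  also have "exp (\<gamma> * real n) = exp (\<gamma> * real D) * exp (- \<gamma>)"
    by (simp add: n(2) right_diff_distrib flip: exp_add)
  also have "(\<tau> * (c1 * (exp (\<gamma> * real D) * exp (- \<gamma>))))\<^sup>2 = c * X"
    by (simp only: c_def X_def power_mult_distrib mult_ac)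
  finally have low: "c * X \<le> rho_sqrt_sq s n" .
  have "g * c2\<^sup>2 * X = g * c2\<^sup>2 / c * (c * X)" using c by simp
  also have "\<dots> \<le> M * rho_sqrt_sq s n"
    using low c X by (intro mult_mono) (auto simp: M_def)
  finally have upper: "g * c2\<^sup>2 * X \<le> M * rho_sqrt_sq s n" .
  have "sqrt (real D) * (s D)\<^sup>2 \<le> sqrt (real D) * (M * rho_sqrt_sq s n)"
    using sD upper by (intro mult_left_mono) auto
  then show "rho_controls_noise M (sqrt (real D)) s D"
    using S upper unfolding n_def rho_controls_noise_def by (simp add: mult_ac)
qed

lemma noise_level_comparable:
  assumes "comparable_on {1..N} c1 c2 (\<lambda>j. inverse (b j)) w" "0 < \<sigma>" "j \<in> {1..D}" "D \<le> N"
  shows "\<sigma> * (c1 * w j) \<le> noise_level \<sigma> b j \<and> noise_level \<sigma> b j \<le> \<sigma> * (c2 * w j)"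
  using assms by (auto simp: comparable_on_def noise_level_def)

theorem proposition4:
  fixes \<alpha> \<beta> p :: real
  assumes "0 < \<alpha>" "\<alpha> < 1" and "0 < \<beta>" "\<beta> < 1" and "0 < p" "p < 2"
  shows
    "(\<forall>t>0. \<forall>c1>0. \<forall>c2>0. \<exists>C>0.
        \<forall>(N::nat) (R::real) (\<sigma>::real) (a::nat \<Rightarrow> real) (b::nat \<Rightarrow> real).
          2 \<le> N \<and> 0 < R \<and> 0 < \<sigma> \<and>
          (\<forall>j\<in>{1..N}. 0 < a j) \<and> mono_on {1..N} a \<and>
          (\<forall>j\<in>{1..N}. 0 < b j) \<and>
          antimono_on {1..N} (\<lambda>j. a j powr (- p) * b j powr (- (2 - p))) \<and>
          comparable_on {1..N} c1 c2 (\<lambda>j. inverse (b j)) (\<lambda>j. real j powr t) \<longrightarrow>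
          sup_type_II_error N \<sigma> b a p R \<alpha>
            (C * ln (real N) * rate_sq N (noise_level \<sigma> b) a p R) \<le> ennreal \<beta>)
     \<and>
     (\<forall>\<gamma>>0. \<forall>c1>0. \<forall>c2>0. \<exists>C>0.
        \<forall>(N::nat) (R::real) (\<sigma>::real) (a::nat \<Rightarrow> real) (b::nat \<Rightarrow> real).
          2 \<le> N \<and> 0 < R \<and> 0 < \<sigma> \<and>
          (\<forall>j\<in>{1..N}. 0 < a j) \<and> mono_on {1..N} a \<and>
          (\<forall>j\<in>{1..N}. 0 < b j) \<and>
          antimono_on {1..N} (\<lambda>j. a j powr (- p) * b j powr (- (2 - p))) \<and>
          comparable_on {1..N} c1 c2 (\<lambda>j. inverse (b j)) (\<lambda>j. exp (\<gamma> * real j)) \<longrightarrow>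
          sup_type_II_error N \<sigma> b a p R \<alpha>
            (C * ln (real N)
               * sqrt (real (D_dagger N (noise_level \<sigma> b) a p R)) powr (1 - p / 2)
               * rate_sq N (noise_level \<sigma> b) a p R) \<le> ennreal \<beta>)"
proof (intro conjI allI impI)
  fix t c1 c2 :: real
  assume t: "0 < t" and c: "0 < c1" "0 < c2"
  obtain M where "1 \<le> M" and noise: "\<And>D \<tau> s. 2 \<le> D \<Longrightarrow> 0 < \<tau> \<Longrightarrow>
      (\<And>j. j \<in> {1..D} \<Longrightarrow> \<tau> * (c1 * real j powr t) \<le> s j \<and> s j \<le> \<tau> * (c2 * real j powr t)) \<Longrightarrow>
      rho_controls_noise M 1 s D"
    using polynomial_noise_bounds[OF c t] by metis
  obtain C where "C > 0" and C: "\<And>N R \<sigma> a b h. admissible p N R \<sigma> a b \<Longrightarrow> 1 \<le> h \<Longrightarrow>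
      (2 \<le> D_dagger N (noise_level \<sigma> b) a p R \<Longrightarrow>
        rho_controls_noise M h (noise_level \<sigma> b) (D_dagger N (noise_level \<sigma> b) a p R)) \<Longrightarrow>
      sup_type_II_error N \<sigma> b a p R \<alpha>
        (C * ln (real N) * h powr (1 - p / 2) * rate_sq N (noise_level \<sigma> b) a p R) \<le> ennreal \<beta>"
    using sup_type_II_error_le[OF assms \<open>1 \<le> M\<close>] by metis
  have bound: "sup_type_II_error N \<sigma> b a p R \<alpha>
      (C * ln (real N) * rate_sq N (noise_level \<sigma> b) a p R) \<le> ennreal \<beta>"
    if adm: "admissible p N R \<sigma> a b"
      and comp: "comparable_on {1..N} c1 c2 (\<lambda>j. inverse (b j)) (\<lambda>j. real j powr t)" for N R \<sigma> a b
  proof -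
    have \<sigma>: "0 < \<sigma>" and N: "1 \<le> N" using adm by (auto simp: admissible_def)
    have D: "1 \<le> D_dagger N (noise_level \<sigma> b) a p R" "D_dagger N (noise_level \<sigma> b) a p R \<le> N"
      using D_dagger_mem[OF N, of "noise_level \<sigma> b" a p R] by simp_all
    show ?thesis
      using C[OF adm, of "1"] D(1)
        noise[OF _ \<sigma> noise_level_comparable[OF comp \<sigma> _ D(2)]]
      by simp
  qed
  show "\<exists>C>0. \<forall>(N::nat) R \<sigma> a b.
          2 \<le> N \<and> 0 < R \<and> 0 < \<sigma> \<and> (\<forall>j\<in>{1..N}. 0 < a j) \<and> mono_on {1..N} a \<and> (\<forall>j\<in>{1..N}. 0 < b j) \<and>
          antimono_on {1..N} (\<lambda>j. a j powr (- p) * b j powr (- (2 - p))) \<and>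
          comparable_on {1..N} c1 c2 (\<lambda>j. inverse (b j)) (\<lambda>j. real j powr t) \<longrightarrow>
          sup_type_II_error N \<sigma> b a p R \<alpha>
            (C * ln (real N) * rate_sq N (noise_level \<sigma> b) a p R) \<le> ennreal \<beta>"
    by (intro exI[of _ C] conjI allI impI \<open>C > 0\<close> bound; elim conjE)
       (auto simp: admissible_def)
next
  fix \<gamma> c1 c2 :: real
  assume \<gamma>: "0 < \<gamma>" and c: "0 < c1" "0 < c2"
  obtain M where "1 \<le> M" and noise: "\<And>D \<tau> s. 2 \<le> D \<Longrightarrow> 0 < \<tau> \<Longrightarrow>
      (\<And>j. j \<in> {1..D} \<Longrightarrow> \<tau> * (c1 * exp (\<gamma> * real j)) \<le> s j \<and> s j \<le> \<tau> * (c2 * exp (\<gamma> * real j))) \<Longrightarrow>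
      rho_controls_noise M (sqrt (real D)) s D"
    using exponential_noise_bounds[OF c \<gamma>] by metis
  obtain C where "C > 0" and C: "\<And>N R \<sigma> a b h. admissible p N R \<sigma> a b \<Longrightarrow> 1 \<le> h \<Longrightarrow>
      (2 \<le> D_dagger N (noise_level \<sigma> b) a p R \<Longrightarrow>
        rho_controls_noise M h (noise_level \<sigma> b) (D_dagger N (noise_level \<sigma> b) a p R)) \<Longrightarrow>
      sup_type_II_error N \<sigma> b a p R \<alpha>
        (C * ln (real N) * h powr (1 - p / 2) * rate_sq N (noise_level \<sigma> b) a p R) \<le> ennreal \<beta>"
    using sup_type_II_error_le[OF assms \<open>1 \<le> M\<close>] by metis
  have bound: "sup_type_II_error N \<sigma> b a p R \<alpha>
      (C * ln (real N) * sqrt (real (D_dagger N (noise_level \<sigma> b) a p R)) powr (1 - p / 2)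
            * rate_sq N (noise_level \<sigma> b) a p R) \<le> ennreal \<beta>"
    if adm: "admissible p N R \<sigma> a b"
      and comp: "comparable_on {1..N} c1 c2 (\<lambda>j. inverse (b j)) (\<lambda>j. exp (\<gamma> * real j))" for N R \<sigma> a b
  proof -
    have \<sigma>: "0 < \<sigma>" and N: "1 \<le> N" using adm by (auto simp: admissible_def)
    have D: "1 \<le> D_dagger N (noise_level \<sigma> b) a p R" "D_dagger N (noise_level \<sigma> b) a p R \<le> N"
      using D_dagger_mem[OF N, of "noise_level \<sigma> b" a p R] by simp_all
    show ?thesis
      using C[OF adm, of "sqrt (real (D_dagger N (noise_level \<sigma> b) a p R))"] D(1)
        noise[OF _ \<sigma> noise_level_comparable[OF comp \<sigma> _ D(2)]]
      by simp
  qed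
  show "\<exists>C>0. \<forall>(N::nat) R \<sigma> a b.
          2 \<le> N \<and> 0 < R \<and> 0 < \<sigma> \<and> (\<forall>j\<in>{1..N}. 0 < a j) \<and> mono_on {1..N} a \<and> (\<forall>j\<in>{1..N}. 0 < b j) \<and>
          antimono_on {1..N} (\<lambda>j. a j powr (- p) * b j powr (- (2 - p))) \<and>
          comparable_on {1..N} c1 c2 (\<lambda>j. inverse (b j)) (\<lambda>j. exp (\<gamma> * real j)) \<longrightarrow>
          sup_type_II_error N \<sigma> b a p R \<alpha>
            (C * ln (real N) * sqrt (real (D_dagger N (noise_level \<sigma> b) a p R)) powr (1 - p / 2)
            * rate_sq N (noise_level \<sigma> b) a p R) \<le> ennreal \<beta>"
    by (intro exI[of _ C] conjI allI impI \<open>C > 0\<close> bound; elim conjE)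
       (auto simp: admissible_def)
qed

end
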